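(* Let $p\ge1$ be an integer, $0<r_1<\dots<r_p$ real numbers, $\mathcal{K}$ a compact subset of $\mathbb{R}^+\setminus\{0\}$ and $\Theta$ a bounded open subset of $\mathbb{R}^p$. For $\alpha\in\mathcal{K}$, $\theta=(\theta_1,\dots,\theta_p)\in\Theta$, $\Lambda\in\mathcal{B}(\mathbb{R}^d)$, $\gamma\in\mathcal{M}(\mathbb{R}^d)$, define (hard sphere model with pairwise step interaction) $$H^{\alpha,\theta}_\Lambda(\gamma)=\sum_{\{x,y\}\subset\gamma,\ \{x,y\}\cap\Lambda\ne\emptyset}\Big(+\infty\,\mathbf{1}_{[0,1/\alpha]}(|x-y|)+\theta_1\mathbf{1}_{]1/\alpha,\,1/\alpha+r_1]}(|x-y|)+\dots+\theta_p\mathbf{1}_{]1/\alpha+r_{p-1},\,1/\alpha+r_p]}(|x-y|)\Big).$$ Let $(\alpha^*,\theta^* )\in\mathcal{K}\times\Theta$ and let $\mu^{\alpha^*,\theta^*}$ be a stationary Gibbs measure for $(H^{\alpha^*,\theta^*}_\Lambda)$. Then the following properties hold. (S1) For all $\gamma\in\mathcal{M}(\mathbb{R}^d)$, $\alpha\in\mathcal{K}$, $\theta,\theta'\in\Theta$, $\Lambda\in\mathcal{B}(\mathbb{R}^d)$: $H^{\alpha,\theta}_\Lambda(\gamma)<\infty\iff H^{\alpha,\theta'}_\Lambda(\gamma)<\infty$. (S2) For all $\gamma\in\mathcal{M}(\mathbb{R}^d)$, $\alpha\le\alpha'$, $\theta\in\Theta$, $\Lambda\in\mathcal{B}(\mathbb{R}^d)$: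 $H^{\alpha,\theta}_\Lambda(\gamma)<\infty\Rightarrow H^{\alpha',\theta}_\Lambda(\gamma)<\infty$. (S3) For every $\alpha<\alpha^*$ there is $R_\alpha>0$ such that every stationary Gibbs measure $\mu$ for $(H^{\alpha^*,\theta^*}_\Lambda)$ satisfies $\mu(H^{\alpha,\theta^*}_{B(0,R_\alpha)}(\gamma)=+\infty)>0$. (S4) For all $\gamma\in\mathcal{M}(\mathbb{R}^d)$, $\Lambda\in\mathcal{B}(\mathbb{R}^d)$, $\theta\in\Theta$ and $\alpha'$ with $H^{\alpha',\theta}_\Lambda(\gamma)<+\infty$, there is $\alpha<\alpha'$ with $H^{\alpha,\theta}_\Lambda(\gamma)<+\infty$. (H2) For all $(\alpha,\theta)$, $h^{\alpha,\theta}(x+y,\gamma_y)=h^{\alpha,\theta}(x,\gamma)$ for all $x,y\in\mathbb{R}^d$ and all $\gamma$ for which the local energy is defined, where $\gamma_y$ is $\gamma$ translated by $y$. (H3) There is $K\ge0$ such that $h^{\alpha,\theta}(x,\gamma)\ge-K$ for all $(\alpha,\theta)\in\mathcal{K}\times\Theta$, $\gamma\in\mathcal{M}^\alpha_\infty(\mathbb{R}^d)$, $x\in\mathbb{R}^d$. (H4) For all $\theta\in\Theta$, $h^{\alpha^*,\theta}(0,\cdot)\exp(-h^{\alpha^*,\theta^*}(0,\cdot))\in L^1(\mu^{\alpha^*,\theta^*})$, with the convention $\infty e^{-\infty}=0$. (H5) For all $\theta\in\Theta\setminus\{\theta^*\}$, $\mu^{\alpha^*,\theta^*}(h^{\alpha^*,\theta^*}(0,\cdot)\ne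 h^{\alpha^*,\theta}(0,\cdot))>0$. (H6$'$) There are a real function $\delta$ with $\delta(x)\to0$ as $x\to0$ and $g\in L^1(\mu^{\alpha^*,\theta^*})$ such that, for $\mu^{\alpha^*,\theta^*}$-a.e. $\gamma\in\mathcal{M}^{\alpha^*}_\infty(\mathbb{R}^d)$, all $\alpha\le\alpha^*$ in $\mathcal{K}$ and all $(\theta,\theta')\in\Theta^2$: if $0\in\mathcal{R}^\alpha(\gamma+\delta_0)$ and $h^{\alpha,\theta}(0,\gamma)<\infty$, then $|h^{\alpha,\theta}(0,\gamma)-h^{\alpha^*,\theta'}(0,\gamma)|\le g(\gamma)[\delta(|\alpha-\alpha^*|)+\delta(|\theta-\theta'|)]$.
   Context: Fix an integer $d$ greater than $1$. $\mathcal{B}(\mathbb{R}^d)$: bounded Borel sets of $\mathbb{R}^d$; $\lambda$: Lebesgue measure; $B(x,r)$: open ball. $\mathcal{M}(\mathbb{R}^d)$: simple integer-valued measures $\gamma$ on $\mathbb{R}^d$ ($\gamma(\Lambda)\in\mathbb{N}$ for $\Lambda\in\mathcal{B}(\mathbb{R}^d)$, $\gamma(\{x\})\le1$), with the $\sigma$-algebra generated by the counts $\gamma(\Lambda)$. $x\in\gamma$ means $\gamma(\{x\})>0$; $\gamma_\Lambda=\sum_{x\in\gamma\cap\Lambda}\delta_x$. $\pi_\Lambda$: Poisson process on $\Lambda$ with intensity $\mathbf{1}_\Lambda\lambda$. Convention $+\infty\cdot0=0$; sums containing a $+\infty$ term equal $+\infty$. For a family of energies $(H_\Lambda)_{\Lambda\in\mathcal{B}(\mathbb{R}^d)}$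 (satisfying $H_{\Lambda'}(\gamma)=H_\Lambda(\gamma)+\varphi_{\Lambda,\Lambda'}(\gamma_{\Lambda^c})$ for $\Lambda\subset\Lambda'$): $\mathcal{M}_\infty(\mathbb{R}^d)$ is the set of $\gamma$ with $H_\Lambda(\gamma)<+\infty$ for all $\Lambda\in\mathcal{B}(\mathbb{R}^d)$. A point $x\in\gamma$ is removable from $\gamma$ if some $\Lambda\in\mathcal{B}(\mathbb{R}^d)$ satisfies $x\in\Lambda$, $H_\Lambda(\gamma-\delta_x)<+\infty$; $\mathcal{R}(\gamma)$ is the set of removable points, and for $x\in\mathcal{R}(\gamma)$ the local energy is $h(x,\gamma-\delta_x)=H_\Lambda(\gamma)-H_\Lambda(\gamma-\delta_x)\in\mathbb{R}\cup\{+\infty\}$ for any such $\Lambda$ (independent of the choice). So $h(x,\gamma)$ is defined whenever $x\in\mathcal{R}(\gamma+\delta_x)$, in particular for $\gamma\in\mathcal{M}_\infty(\mathbb{R}^d)$. For $(H^{\alpha,\theta}_\Lambda)$, where by (S1) they depend only on $\alpha$, the first two objects are written $\mathcal{M}^\alpha_\infty(\mathbb{R}^d)$, $\mathcal{R}^\alpha(\gamma)$; the local energy is written $h^{\alpha,\theta}$. A probability measure $\mu$ on $\mathcal{M}(\mathbb{R}^d)$ is a Gibbs measure for $(H_\Lambda)$ if $\int f\,\mathrm{d}\mu=\int\int_{\mathcal{M}(\Lambda)}f(\gamma'_\Lambda+\gamma_{\Lambda^c})\frac{e^{-H_\Lambda(\gamma'_\Lambda+\gamma_{\Lambda^c})}}{Z_\Lambda(\gamma_{\Lambda^c})}\pi_\Lambda(\mathrm{d}\gamma'_\Lambda)\mu(\mathrm{d}\gamma)$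 for all $\Lambda\in\mathcal{B}(\mathbb{R}^d)$ and bounded measurable $f$, where $Z_\Lambda(\gamma_{\Lambda^c})=\int_{\mathcal{M}(\Lambda)}e^{-H_\Lambda(\gamma'_\Lambda+\gamma_{\Lambda^c})}\pi_\Lambda(\mathrm{d}\gamma'_\Lambda)$ is assumed in $(0,+\infty)$ for $\gamma\in\mathcal{M}_\infty(\mathbb{R}^d)$. Stationary: translation invariant. The parameters $\alpha,\alpha'$ range over $\mathcal{K}$, except that in (S4) the value $\alpha<\alpha'$ is any positive real, the energy being given by the same formula. In the first $\theta$-step the interval is $]1/\alpha,1/\alpha+r_1]$. *)

theory Defs
  imports "HOL-Probability.Probability"
begin

section \<open>Point configurations\<close>

definition bounded_borel :: "'v::euclidean_space set set" where
  "bounded_borel = {\<Lambda>. \<Lambda> \<in> sets borel \<and> bounded \<Lambda>}"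

definition configs :: "'v::euclidean_space measure set" where
  "configs = {\<gamma>. sets \<gamma> = sets borel \<and>
     (\<forall>\<Lambda>\<in>bounded_borel. emeasure \<gamma> \<Lambda> \<in> \<nat>) \<and> (\<forall>x. emeasure \<gamma> {x} \<le> 1)}"

definition config_space :: "'v::euclidean_space measure measure" where
  "config_space = sigma configs
     {{\<gamma> \<in> configs. emeasure \<gamma> \<Lambda> \<in> B} | \<Lambda> B. \<Lambda> \<in> bounded_borel \<and> B \<in> sets borel}"

definition points :: "'v::euclidean_space measure \<Rightarrow> 'v set" where
  "points \<gamma> = {x. emeasure \<gamma> {x} > 0}"

definition restr :: "'v::euclidean_space measure \<Rightarrow> 'v set \<Rightarrow> 'v measure" where
  "restr \<gamma> \<Lambda> = density \<gamma> (indicator \<Lambda>)"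

definition add_measure :: "'v measure \<Rightarrow> 'v measure \<Rightarrow> 'v measure" where
  "add_measure M N = measure_of (space M) (sets M) (\<lambda>A. emeasure M A + emeasure N A)"

definition add_point :: "'v::euclidean_space measure \<Rightarrow> 'v \<Rightarrow> 'v measure" where
  "add_point \<gamma> x = add_measure \<gamma> (return borel x)"

definition del_point :: "'v::euclidean_space measure \<Rightarrow> 'v \<Rightarrow> 'v measure" where
  "del_point \<gamma> x = diff_measure \<gamma> (return borel x)"

definition translate :: "'v::euclidean_space \<Rightarrow> 'v measure \<Rightarrow> 'v measure" where
  "translate y \<gamma> = distr \<gamma> borel (\<lambda>x. x + y)"

text \<open>The law of a Poisson process with locally finite intensity \<open>\<nu>\<close>. The Poisson weights are
  written out because the rate may be 0. Independence over sequences of pairwise disjoint sets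
  covers finite families, as members of the sequence may be empty.\<close>

definition poisson_process :: "'v::euclidean_space measure \<Rightarrow> 'v measure measure \<Rightarrow> bool" where
  "poisson_process \<nu> P \<longleftrightarrow>
     prob_space P \<and> sets P = sets config_space \<and>
     (\<forall>A\<in>bounded_borel. \<forall>n::nat.
        measure P {\<gamma> \<in> space P. emeasure \<gamma> A = of_nat n}
          = measure \<nu> A ^ n / fact n * exp (- measure \<nu> A)) \<and>
     (\<forall>A::nat \<Rightarrow> 'v set. range A \<subseteq> bounded_borel \<and> disjoint_family A \<longrightarrow>
        prob_space.indep_vars P (\<lambda>_. borel) (\<lambda>i \<gamma>. emeasure \<gamma> (A i)) UNIV)"

section \<open>Families of energies, local energies and Gibbs measures\<close>

type_synonym 'v energy = "'v set \<Rightarrow> 'v measure \<Rightarrow> ereal"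

definition finite_energy_configs :: "'v::euclidean_space energy \<Rightarrow> 'v measure set" where
  "finite_energy_configs H = {\<gamma> \<in> configs. \<forall>\<Lambda>\<in>bounded_borel. H \<Lambda> \<gamma> < \<infinity>}"

text \<open>Since \<open>removable\<close> requires a simple configuration, \<open>x \<in> removable H (add_point \<gamma> x)\<close>
  entails that \<open>x\<close> is not already a point of \<open>\<gamma>\<close>.\<close>

definition removable :: "'v::euclidean_space energy \<Rightarrow> 'v measure \<Rightarrow> 'v set" where
  "removable H \<gamma> = {x \<in> points \<gamma>. \<gamma> \<in> configs \<and>
     (\<exists>\<Lambda>\<in>bounded_borel. x \<in> \<Lambda> \<and> H \<Lambda> (del_point \<gamma> x) < \<infinity>)}"

text \<open>For compatible families of energies the value does not depend on the chosen \<open>\<Lambda>\<close>.\<close>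

definition local_energy :: "'v::euclidean_space energy \<Rightarrow> 'v \<Rightarrow> 'v measure \<Rightarrow> ereal" where
  "local_energy H x \<gamma> =
     (if x \<in> removable H (add_point \<gamma> x)
      then let \<Lambda> = SOME \<Lambda>. \<Lambda> \<in> bounded_borel \<and> x \<in> \<Lambda> \<and> H \<Lambda> \<gamma> < \<infinity>
           in H \<Lambda> (add_point \<gamma> x) - H \<Lambda> \<gamma>
      else undefined)"

text \<open>The map taking \<open>u\<close> to \<open>exp (- u)\<close> for \<open>u\<close> real or \<open>\<infinity>\<close>; energies never take
  the value \<open>-\<infinity>\<close>.\<close>

definition boltzmann :: "ereal \<Rightarrow> real" where
  "boltzmann u = (if u = \<infinity> then 0 else exp (- real_of_ereal u))"

definition glue :: "'v::euclidean_space set \<Rightarrow> 'v measure \<Rightarrow> 'v measure \<Rightarrow> 'v measure" where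
  "glue \<Lambda> \<gamma>' \<gamma> = add_measure (restr \<gamma>' \<Lambda>) (restr \<gamma> (- \<Lambda>))"

text \<open>Here and in \<open>gibbs_measure\<close> the argument \<open>P\<close> (respectively \<open>\<pi> \<Lambda>\<close>) stands for the
  Poisson process on \<open>\<Lambda>\<close> with unit intensity.\<close>

definition partition_function ::
    "'v::euclidean_space measure measure \<Rightarrow> 'v energy \<Rightarrow> 'v set \<Rightarrow> 'v measure \<Rightarrow> ennreal" where
  "partition_function P H \<Lambda> \<gamma> = (\<integral>\<^sup>+\<gamma>'. ennreal (boltzmann (H \<Lambda> (glue \<Lambda> \<gamma>' \<gamma>))) \<partial>P)"

definition gibbs_measure ::
    "('v::euclidean_space set \<Rightarrow> 'v measure measure) \<Rightarrow> 'v energy \<Rightarrow> 'v measure measure \<Rightarrow> bool" where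
  "gibbs_measure \<pi> H \<mu> \<longleftrightarrow>
     prob_space \<mu> \<and> sets \<mu> = sets config_space \<and>
     (\<forall>\<Lambda>\<in>bounded_borel. \<forall>\<gamma>\<in>finite_energy_configs H.
        0 < partition_function (\<pi> \<Lambda>) H \<Lambda> \<gamma> \<and> partition_function (\<pi> \<Lambda>) H \<Lambda> \<gamma> < \<infinity>) \<and>
     (\<forall>\<Lambda>\<in>bounded_borel. \<forall>f :: 'v measure \<Rightarrow> real.
        f \<in> borel_measurable config_space \<and> bounded (f ` configs) \<longrightarrow>
        (\<integral>\<gamma>. f \<gamma> \<partial>\<mu>) =
        (\<integral>\<gamma>. (\<integral>\<gamma>'. f (glue \<Lambda> \<gamma>' \<gamma>) *
                 (boltzmann (H \<Lambda> (glue \<Lambda> \<gamma>' \<gamma>)) / enn2real (partition_function (\<pi> \<Lambda>) H \<Lambda> \<gamma>))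
               \<partial>\<pi> \<Lambda>) \<partial>\<mu>))"

definition stationary :: "'v::euclidean_space measure measure \<Rightarrow> bool" where
  "stationary \<mu> \<longleftrightarrow> (\<forall>y. distr \<mu> config_space (translate y) = \<mu>)"

definition L1_ereal :: "'a measure \<Rightarrow> ('a \<Rightarrow> ereal) \<Rightarrow> bool" where
  "L1_ereal M f \<longleftrightarrow> f \<in> borel_measurable M \<and> (\<integral>\<^sup>+x. e2ennreal \<bar>f x\<bar> \<partial>M) < \<infinity>"

section \<open>The hard sphere model with pairwise step interaction\<close>

text \<open>The range parameters are \<open>r 1, \<dots>, r p\<close>, and \<open>r 0\<close> is taken to be 0. A point of
  \<open>\<real>\<^sup>p\<close> is a function on \<open>{1..p}\<close> that is \<open>undefined\<close> elsewhere.\<close>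

definition step_interaction ::
    "nat \<Rightarrow> (nat \<Rightarrow> real) \<Rightarrow> real \<Rightarrow> (nat \<Rightarrow> real) \<Rightarrow> real \<Rightarrow> ereal" where
  "step_interaction p r \<alpha> \<theta> t =
     \<infinity> * indicator {0..1/\<alpha>} t +
     ereal (\<Sum>i=1..p. \<theta> i * indicator {1/\<alpha> + r (i - 1) <.. 1/\<alpha> + r i} t)"

text \<open>An unordered pair is a two-element set; its diameter is the distance between the two points.
  Infinitely many pairs may meet \<open>\<Lambda>\<close>, whereas only finitely many of them interact; the sum is
  restricted to the latter because \<open>sum\<close> over an infinite set is 0.\<close>

definition step_energy ::
    "nat \<Rightarrow> (nat \<Rightarrow> real) \<Rightarrow> real \<Rightarrow> (nat \<Rightarrow> real) \<Rightarrow> 'v::euclidean_space energy" where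
  "step_energy p r \<alpha> \<theta> \<Lambda> \<gamma> =
     (\<Sum>e | e \<subseteq> points \<gamma> \<and> card e = 2 \<and> e \<inter> \<Lambda> \<noteq> {} \<and>
            step_interaction p r \<alpha> \<theta> (diameter e) \<noteq> 0.
        step_interaction p r \<alpha> \<theta> (diameter e))"

definition norm_on :: "nat \<Rightarrow> (nat \<Rightarrow> real) \<Rightarrow> real" where
  "norm_on p \<theta> = L2_set \<theta> {1..p}"

definition bounded_open_in_Rp :: "nat \<Rightarrow> (nat \<Rightarrow> real) set \<Rightarrow> bool" where
  "bounded_open_in_Rp p \<Theta> \<longleftrightarrow>
     openin (product_topology (\<lambda>_. euclideanreal) {1..p}) \<Theta> \<and>
     (\<exists>C. \<forall>\<theta>\<in>\<Theta>. norm_on p \<theta> \<le> C)"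

end

(* The energies depend on a configuration only through its set of points. As {x} is a bounded Borel
   set, every x outside the configuration can be added as a removable point, and its local energy is
   the sum of its interactions with the other points: infinite if the hard core is violated, and
   otherwise a weighted sum of the numbers of points in spherical shells. The hard core bounds these
   numbers by a packing constant, which gives (H3) and (H4).

   For (S3) and (H5) the DLR equation in a large ball is used: with positive probability the Poisson
   process puts exactly one point into each of finitely many small balls near the centre and no other
   point into the large ball, and every such configuration has finite energy whatever the boundary
   condition.

   For (H6') the two counts can only differ if a point lies within distance of order |alpha - alpha*|
   outside one of finitely many spheres. By local finiteness these events decrease to the empty set, so
   an integrable weight and a modulus of continuity can be read off from how fast their probabilities
   vanish. *)

theory Submission
  imports Defs
begin

text \<open>Little is given at the outset: configurations are abstract measures, and the DLR
  equation relates Bochner integrals in which neither the weight nor the inner integral is known to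
  be measurable. The first obstacle is met by showing, from integrality and simplicity, that a
  configuration counts a locally finite set of points. The second is met by using the DLR equation
  only where the inner integrand is almost everywhere 0, or where the outer integral has the value
  1, which no default value can imitate.

  The boundary condition is harmless because finiteness of the energy concerns the hard core alone:
  the prescribed points lie so deep inside the ball that every outside point is farther away than
  the hard-core diameter.

  Strict margins come from local finiteness: a hard core can be widened a little, and no point lies
  just outside a given sphere. In (H6') only \<alpha> \<le> \<alpha>star is compared, so all spheres
  move outwards; the shells swept exclude their inner sphere, and this is why the events shrink to
  the empty set.\<close>

section \<open>Point configurations\<close>

lemma bounded_borelI: "\<Lambda> \<in> sets borel \<Longrightarrow> bounded \<Lambda> \<Longrightarrow> \<Lambda> \<in> bounded_borel"
  by (simp add: bounded_borel_def)

lemma bounded_borelD: "\<Lambda> \<in> bounded_borel \<Longrightarrow> \<Lambda> \<in> sets borel" "\<Lambda> \<in> bounded_borel \<Longrightarrow> bounded \<Lambda>"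
  by (simp_all add: bounded_borel_def)

lemma bounded_borel_subset:
  "\<Lambda> \<in> bounded_borel \<Longrightarrow> A \<in> sets borel \<Longrightarrow> A \<subseteq> \<Lambda> \<Longrightarrow> A \<in> bounded_borel"
  unfolding bounded_borel_def by (blast intro: bounded_subset)

lemma bounded_borel_Int: "\<Lambda> \<in> bounded_borel \<Longrightarrow> A \<in> sets borel \<Longrightarrow> A \<inter> \<Lambda> \<in> bounded_borel"
  by (rule bounded_borel_subset[of \<Lambda>]) (use bounded_borelD(1)[of \<Lambda>] in auto)

lemma bounded_borel_basic [simp]:
  "{x} \<in> bounded_borel" "ball x e \<in> bounded_borel" "cball x e \<in> bounded_borel" "{} \<in> bounded_borel"
  by (auto intro!: bounded_borelI)

lemma configsD:
  assumes "\<gamma> \<in> configs"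
  shows sets_configs: "sets \<gamma> = sets borel" and space_configs: "space \<gamma> = UNIV"
    and configs_Nats: "\<Lambda> \<in> bounded_borel \<Longrightarrow> emeasure \<gamma> \<Lambda> \<in> \<nat>"
    and configs_simple: "emeasure \<gamma> {x} \<le> 1"
  using assms sets_eq_imp_space_eq[of \<gamma> borel] by (auto simp: configs_def)

lemma Nats_lt_1_ennreal: "(c :: ennreal) \<in> \<nat> \<Longrightarrow> c < 1 \<Longrightarrow> c = 0"
  by (auto elim!: Nats_cases)

lemma Nats_finite_ennreal: "(c :: ennreal) \<in> \<nat> \<Longrightarrow> c \<noteq> \<infinity>"
  by (auto elim!: Nats_cases)

lemma emeasure_point:
  assumes "\<gamma> \<in> configs" "x \<in> points \<gamma>"
  shows "emeasure \<gamma> {x} = 1"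
proof -
  have "emeasure \<gamma> {x} \<in> \<nat>" "emeasure \<gamma> {x} \<le> 1" "emeasure \<gamma> {x} > 0"
    using configs_Nats[OF assms(1)] configs_simple[OF assms(1)] assms(2) by (auto simp: points_def)
  then show ?thesis using Nats_lt_1_ennreal by (metis order_le_less less_irrefl)
qed

text \<open>By integrality the mass of small balls around a point that is not an atom vanishes, so
  compactness of the closure gives total mass zero.\<close>

lemma configs_null_if_no_points:
  fixes B :: "'v::euclidean_space set"
  assumes \<gamma>: "\<gamma> \<in> configs" and B: "B \<in> bounded_borel" and no: "points \<gamma> \<inter> B = {}"
  shows "emeasure \<gamma> B = 0"
proof -
  note [simp] = sets_configs[OF \<gamma>]
  have Bb: "B \<in> sets borel" using B by (rule bounded_borelD)
  have "\<exists>e>0. emeasure \<gamma> (ball x e \<inter> B) = 0" for x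
  proof -
    let ?A = "\<lambda>n. ball x (1 / real (Suc n)) \<inter> B"
    have A: "?A n \<in> bounded_borel" for n using B by (intro bounded_borel_Int) auto
    have "(\<lambda>n. emeasure \<gamma> (?A n)) \<longlonglongrightarrow> emeasure \<gamma> (\<Inter>n. ?A n)"
    proof (rule Lim_emeasure_decseq)
      show "range ?A \<subseteq> sets \<gamma>" using A bounded_borelD(1) by auto
      have "1 / real (Suc n) \<le> 1 / real (Suc m)" if "m \<le> n" for m n
        using that by (intro divide_left_mono) auto
      then show "decseq ?A" unfolding decseq_def
        by (intro allI impI Int_mono subset_ball order_refl)
      show "emeasure \<gamma> (?A i) \<noteq> \<infinity>" for i
        using configs_Nats[OF \<gamma> A] by (rule Nats_finite_ennreal)
    qed
    moreover have "(\<Inter>n. ?A n) = {x} \<inter> B"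
    proof -
      have "y = x" if "\<forall>n. dist x y < 1 / real (Suc n)" for y
      proof (rule ccontr)
        assume "y \<noteq> x"
        then have "0 < dist x y" by simp
        then obtain n where "1 / real (Suc n) < dist x y" using nat_approx_posE by blast
        with that show False by (meson not_less_iff_gr_or_eq)
      qed
      then show ?thesis by auto
    qed
    moreover have "emeasure \<gamma> ({x} \<inter> B) = 0"
    proof (cases "x \<in> B")
      case True
      then have "x \<notin> points \<gamma>" using no by auto
      then have "emeasure \<gamma> {x} = 0" by (simp add: points_def)
      with True show ?thesis by (simp add: Int_absorb2)
    qed simp
    ultimately have "(\<lambda>n. emeasure \<gamma> (?A n)) \<longlonglongrightarrow> 0" by simp
    then have "\<forall>\<^sub>F n in sequentially. emeasure \<gamma> (?A n) < 1" by (rule order_tendstoD) simp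
    then obtain n where "emeasure \<gamma> (?A n) < 1" by (auto simp: eventually_sequentially)
    then have "emeasure \<gamma> (?A n) = 0" using configs_Nats[OF \<gamma> A] Nats_lt_1_ennreal by blast
    then show ?thesis by (intro exI[of _ "1 / real (Suc n)"]) auto
  qed
  then obtain e where e: "\<And>x. e x > 0" "\<And>x. emeasure \<gamma> (ball x (e x) \<inter> B) = 0" by metis
  have "compact (closure B)" using bounded_borelD(2)[OF B] by (simp add: compact_closure)
  then obtain F where F: "F \<subseteq> closure B" "finite F" "closure B \<subseteq> (\<Union>x\<in>F. ball x (e x))"
    by (rule compactE_image[of _ "closure B" "\<lambda>x. ball x (e x)"]) (use e(1) in auto)
  have "B = (\<Union>x\<in>F. ball x (e x) \<inter> B)" using F(3) closure_subset by blast
  also have "emeasure \<gamma> \<dots> \<le> (\<Sum>x\<in>F. emeasure \<gamma> (ball x (e x) \<inter> B))"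
    by (rule emeasure_subadditive_finite) (use F(2) Bb in auto)
  also have "\<dots> = 0" by (simp add: e(2))
  finally show ?thesis by simp
qed

lemma emeasure_finite_points:
  assumes \<gamma>: "\<gamma> \<in> configs" and F: "finite F" "F \<subseteq> points \<gamma>"
  shows "emeasure \<gamma> F = of_nat (card F)"
proof -
  have "emeasure \<gamma> F = (\<Sum>x\<in>F. emeasure \<gamma> {x})"
    by (rule emeasure_eq_sum_singleton[OF F(1)]) (simp add: sets_configs[OF \<gamma>])
  also have "\<dots> = (\<Sum>x\<in>F. 1)" by (rule sum.cong) (use F(2) emeasure_point[OF \<gamma>] in auto)
  finally show ?thesis by simp
qed

text \<open>Atoms have mass one, so the finite mass of an enclosing closed ball caps the size of
  every finite set of atoms in it.\<close>

lemma finite_points: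
  assumes \<gamma>: "\<gamma> \<in> configs" and B: "bounded B"
  shows "finite (points \<gamma> \<inter> B)"
proof -
  obtain b where b: "B \<subseteq> cball 0 b" using bounded_subset_ballD[OF B, of 0] ball_subset_cball by blast
  let ?C = "cball 0 b :: 'a set"
  obtain n where n: "emeasure \<gamma> ?C = of_nat n"
    using configs_Nats[OF \<gamma>, of ?C] by (auto elim!: Nats_cases)
  have "card F \<le> n" if "finite F" "F \<subseteq> points \<gamma> \<inter> ?C" for F
  proof -
    have "of_nat (card F) = emeasure \<gamma> F" using emeasure_finite_points[OF \<gamma>, of F] that by simp
    also have "\<dots> \<le> emeasure \<gamma> ?C" by (rule emeasure_mono) (use that sets_configs[OF \<gamma>] in auto)
    also note n
    finally show ?thesis by simp
  qed
  then have "finite (points \<gamma> \<inter> ?C)"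
    using finite_if_finite_subsets_card_bdd[of "points \<gamma> \<inter> ?C" n] by blast
  then show ?thesis by (rule rev_finite_subset) (use b in auto)
qed

text \<open>The part of \<open>B\<close> without atoms is null and each atom weighs one. From here
  on a configuration can be treated as the counting measure of a locally finite set.\<close>

lemma emeasure_configs:
  assumes \<gamma>: "\<gamma> \<in> configs" and B: "B \<in> bounded_borel"
  shows "emeasure \<gamma> B = of_nat (card (points \<gamma> \<inter> B))"
proof -
  let ?P = "points \<gamma> \<inter> B"
  have fin: "finite ?P" by (rule finite_points[OF \<gamma> bounded_borelD(2)[OF B]])
  have P: "?P \<in> sets borel" using fin by (simp add: borel_closed finite_imp_closed)
  have "B - ?P \<in> bounded_borel"
    by (rule bounded_borel_subset[OF B]) (use P bounded_borelD(1)[OF B] in auto)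
  then have "emeasure \<gamma> (B - ?P) = 0" by (rule configs_null_if_no_points[OF \<gamma>]) auto
  moreover have "emeasure \<gamma> B = emeasure \<gamma> ?P + emeasure \<gamma> (B - ?P)"
    by (subst plus_emeasure) (use P bounded_borelD(1)[OF B] sets_configs[OF \<gamma>] in \<open>auto intro!: arg_cong[where f = "emeasure \<gamma>"]\<close>)
  ultimately show ?thesis using emeasure_finite_points[OF \<gamma> fin] by simp
qed

lemma emeasure_configs_eq_0_iff:
  assumes "\<gamma> \<in> configs" "B \<in> bounded_borel"
  shows "emeasure \<gamma> B = 0 \<longleftrightarrow> points \<gamma> \<inter> B = {}"
  using emeasure_configs[OF assms] finite_points[OF assms(1) bounded_borelD(2)[OF assms(2)]] by simp

lemma emeasure_configs_eq_of_nat_iff: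
  assumes "\<gamma> \<in> configs" "B \<in> bounded_borel"
  shows "emeasure \<gamma> B = of_nat n \<longleftrightarrow> card (points \<gamma> \<inter> B) = n"
  using emeasure_configs[OF assms] by simp

lemma enn2real_emeasure_configs:
  assumes "\<gamma> \<in> configs" "B \<in> bounded_borel"
  shows "enn2real (emeasure \<gamma> B) = real (card (points \<gamma> \<inter> B))"
  using emeasure_configs[OF assms] by (simp add: ennreal_of_nat_eq_real_of_nat)

subsection \<open>Operations on configurations\<close>

text \<open>\<open>measure_of\<close> takes the prescribed values only once the set function is
  known to be a measure, hence the check of countable additivity.\<close>

lemma emeasure_add_measure:
  assumes "sets N = sets M" "A \<in> sets M"
  shows "emeasure (add_measure M N) A = emeasure M A + emeasure N A"
proof (rule emeasure_measure_of[OF add_measure_def])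
  have *: "sets (add_measure M N) = sets M" by (simp add: add_measure_def)
  show "sets M \<subseteq> Pow (space M)" by (rule sets.space_closed)
  show "positive (sets (add_measure M N)) (\<lambda>A. emeasure M A + emeasure N A)"
    by (simp add: positive_def)
  show "countably_additive (sets (add_measure M N)) (\<lambda>A. emeasure M A + emeasure N A)"
    unfolding * countably_additive_def using assms(1)
    by (auto simp: suminf_add[symmetric] suminf_emeasure)
  show "A \<in> sets (add_measure M N)" using assms * by simp
qed

lemma sets_add_measure: "sets (add_measure M N) = sets M"
  by (simp add: add_measure_def)

lemma sets_add_point: "\<gamma> \<in> configs \<Longrightarrow> sets (add_point \<gamma> x) = sets borel"
  by (simp add: add_point_def sets_add_measure sets_configs)

lemma emeasure_add_point:
  assumes "\<gamma> \<in> configs" "A \<in> sets borel"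
  shows "emeasure (add_point \<gamma> x) A = emeasure \<gamma> A + indicator A x"
  using assms by (simp add: add_point_def emeasure_add_measure sets_configs)

lemma points_add_point:
  assumes "\<gamma> \<in> configs"
  shows "points (add_point \<gamma> x) = insert x (points \<gamma>)"
proof -
  have "y \<in> points (add_point \<gamma> x) \<longleftrightarrow> y \<in> insert x (points \<gamma>)" for y
    by (cases "y = x") (simp_all add: points_def emeasure_add_point[OF assms] add_nonneg_pos)
  then show ?thesis by blast
qed

text \<open>Simplicity is what fails when \<open>x\<close> is already a point, since its mass would
  become two. This decides which points are removable.\<close>

lemma add_point_in_configs_iff:
  assumes \<gamma>: "\<gamma> \<in> configs"
  shows "add_point \<gamma> x \<in> configs \<longleftrightarrow> x \<notin> points \<gamma>"
proof
  assume "add_point \<gamma> x \<in> configs"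
  then have "emeasure (add_point \<gamma> x) {x} \<le> 1" by (rule configs_simple)
  then show "x \<notin> points \<gamma>" using emeasure_point[OF \<gamma>, of x] by (auto simp: emeasure_add_point[OF \<gamma>])
next
  assume x: "x \<notin> points \<gamma>"
  have "emeasure (add_point \<gamma> x) {y} \<le> 1" for y
    using x configs_simple[OF \<gamma>, of y]
    by (auto simp: emeasure_add_point[OF \<gamma>] points_def split: split_indicator)
  moreover have "emeasure (add_point \<gamma> x) \<Lambda> \<in> \<nat>" if "\<Lambda> \<in> bounded_borel" for \<Lambda>
    using configs_Nats[OF \<gamma> that] bounded_borelD(1)[OF that]
    by (auto simp: emeasure_add_point[OF \<gamma>] split: split_indicator)
  ultimately show "add_point \<gamma> x \<in> configs"
    by (simp add: configs_def sets_add_point[OF \<gamma>])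
qed

text \<open>Lets \<open>removable\<close>, which deletes \<open>x\<close> from the enlarged
  configuration, be read as a condition on \<gamma> itself.\<close>

lemma del_point_add_point:
  assumes \<gamma>: "\<gamma> \<in> configs"
  shows "del_point (add_point \<gamma> x) x = \<gamma>"
proof -
  have "space (add_point \<gamma> x) = space \<gamma>"
    using sets_add_point[OF \<gamma>] sets_configs[OF \<gamma>] by (metis sets_eq_imp_space_eq)
  moreover have "sets (add_point \<gamma> x) = sets \<gamma>" using sets_add_point[OF \<gamma>] sets_configs[OF \<gamma>] by simp
  ultimately have "del_point (add_point \<gamma> x) x = measure_of (space \<gamma>) (sets \<gamma>)
      (\<lambda>A. emeasure (add_point \<gamma> x) A - emeasure (return borel x) A)"
    by (simp add: del_point_def diff_measure_def)
  also have "\<dots> = measure_of (space \<gamma>) (sets \<gamma>) (emeasure \<gamma>)"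
  proof (rule measure_of_eq[OF sets.space_closed])
    fix A assume "A \<in> sigma_sets (space \<gamma>) (sets \<gamma>)"
    then have "A \<in> sets borel" by (metis sets.sigma_sets_eq sets_configs[OF \<gamma>])
    then show "emeasure (add_point \<gamma> x) A - emeasure (return borel x) A = emeasure \<gamma> A"
      by (simp add: emeasure_add_point[OF \<gamma>] split: split_indicator)
  qed
  also have "\<dots> = \<gamma>" by (rule measure_of_of_measure)
  finally show ?thesis .
qed

lemma emeasure_translate:
  assumes \<gamma>: "\<gamma> \<in> configs" and A: "A \<in> sets borel"
  shows "emeasure (translate y \<gamma>) A = emeasure \<gamma> ((\<lambda>x. x + y) -` A)"
  using A unfolding translate_def
  by (subst emeasure_distr) (auto simp: space_configs[OF \<gamma>] measurable_cong_sets[OF sets_configs[OF \<gamma>] refl])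

lemma bounded_borel_vimage_translate:
  assumes "\<Lambda> \<in> bounded_borel"
  shows "(\<lambda>x. x + y) -` \<Lambda> \<in> bounded_borel"
proof (rule bounded_borelI)
  show "(\<lambda>x. x + y) -` \<Lambda> \<in> sets borel"
    using measurable_sets[of "\<lambda>x. x + y" borel borel \<Lambda>] bounded_borelD(1)[OF assms] by simp
  have "(\<lambda>x. x + y) -` \<Lambda> = (\<lambda>x. - y + x) ` \<Lambda>" by (force simp: algebra_simps image_iff)
  then show "bounded ((\<lambda>x. x + y) -` \<Lambda>)"
    using bounded_translation[OF bounded_borelD(2)[OF assms], of "-y"] by simp
qed

lemma vimage_translate_singleton: "(\<lambda>x. x + y) -` {z} = {z - y :: 'v::euclidean_space}"
  by (auto simp: algebra_simps)

lemma points_translate: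
  assumes "\<gamma> \<in> configs"
  shows "points (translate y \<gamma>) = (\<lambda>x. x + y) ` points \<gamma>"
proof -
  have "z \<in> points (translate y \<gamma>) \<longleftrightarrow> z - y \<in> points \<gamma>" for z
    by (simp add: points_def emeasure_translate[OF assms] vimage_translate_singleton)
  moreover have "z - y \<in> points \<gamma> \<longleftrightarrow> z \<in> (\<lambda>x. x + y) ` points \<gamma>" for z
    using image_eqI[of z "\<lambda>x. x + y" "z - y" "points \<gamma>"] by auto
  ultimately show ?thesis by blast
qed

lemma translate_in_configs:
  assumes "\<gamma> \<in> configs"
  shows "translate y \<gamma> \<in> configs"
proof -
  have "emeasure (translate y \<gamma>) \<Lambda> \<in> \<nat>" if "\<Lambda> \<in> bounded_borel" for \<Lambda>
    using configs_Nats[OF assms bounded_borel_vimage_translate[OF that]]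
    by (simp add: emeasure_translate[OF assms bounded_borelD(1)[OF that]])
  moreover have "emeasure (translate y \<gamma>) {x} \<le> 1" for x
    using configs_simple[OF assms] by (simp add: emeasure_translate[OF assms] vimage_translate_singleton)
  ultimately show ?thesis by (simp add: configs_def translate_def)
qed

lemma sets_restr: "sets (restr \<gamma> A) = sets \<gamma>"
  by (simp add: restr_def)

lemma emeasure_restr:
  assumes "A \<in> sets \<gamma>" "B \<in> sets \<gamma>"
  shows "emeasure (restr \<gamma> A) B = emeasure \<gamma> (A \<inter> B)"
  using assms by (simp add: restr_def emeasure_density indicator_inter_arith[symmetric])

lemma emeasure_glue:
  assumes "\<gamma> \<in> configs" "\<gamma>' \<in> configs" "\<Lambda> \<in> sets borel" "A \<in> sets borel"
  shows "emeasure (glue \<Lambda> \<gamma>' \<gamma>) A = emeasure \<gamma>' (A \<inter> \<Lambda>) + emeasure \<gamma> (A - \<Lambda>)"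
  using assms unfolding glue_def
  by (subst emeasure_add_measure)
     (auto simp: sets_restr sets_configs emeasure_restr Diff_eq Int_commute)

lemma points_glue:
  assumes "\<gamma> \<in> configs" "\<gamma>' \<in> configs" "\<Lambda> \<in> sets borel"
  shows "points (glue \<Lambda> \<gamma>' \<gamma>) = (points \<gamma>' \<inter> \<Lambda>) \<union> (points \<gamma> - \<Lambda>)"
proof -
  have "x \<in> points (glue \<Lambda> \<gamma>' \<gamma>) \<longleftrightarrow> x \<in> (points \<gamma>' \<inter> \<Lambda>) \<union> (points \<gamma> - \<Lambda>)" for x
    by (cases "x \<in> \<Lambda>") (auto simp: points_def emeasure_glue[OF assms] insert_Diff_if)
  then show ?thesis by blast
qed

lemma glue_in_configs:
  assumes "\<gamma> \<in> configs" "\<gamma>' \<in> configs" "\<Lambda> \<in> sets borel"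
  shows "glue \<Lambda> \<gamma>' \<gamma> \<in> configs"
proof -
  have "emeasure (glue \<Lambda> \<gamma>' \<gamma>) A \<in> \<nat>" if "A \<in> bounded_borel" for A
    unfolding emeasure_glue[OF assms bounded_borelD(1)[OF that]]
    using that assms(3) bounded_borelD(1)[OF that]
    by (intro Nats_add configs_Nats assms(1,2) bounded_borel_subset[OF that]) auto
  moreover have "emeasure (glue \<Lambda> \<gamma>' \<gamma>) {x} \<le> 1" for x
    using configs_simple[OF assms(1), of x] configs_simple[OF assms(2), of x]
    by (cases "x \<in> \<Lambda>") (auto simp: emeasure_glue[OF assms] insert_Diff_if)
  moreover have "sets (glue \<Lambda> \<gamma>' \<gamma>) = sets borel"
    by (simp add: glue_def sets_add_measure sets_restr sets_configs[OF assms(2)])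
  ultimately show ?thesis by (simp add: configs_def)
qed

subsection \<open>The configuration space as a measurable space\<close>

lemma config_space_generators:
  "{{\<gamma> \<in> configs. emeasure \<gamma> \<Lambda> \<in> B} | \<Lambda> B. \<Lambda> \<in> bounded_borel \<and> B \<in> sets borel} \<subseteq> Pow configs"
  by auto

lemma space_config_space: "space config_space = configs"
  unfolding config_space_def by (simp add: space_measure_of[OF config_space_generators])

lemma measurable_emeasure_config [measurable]:
  assumes "\<Lambda> \<in> bounded_borel"
  shows "(\<lambda>\<gamma>. emeasure \<gamma> \<Lambda>) \<in> borel_measurable config_space"
proof (rule measurableI)
  fix B :: "ennreal set" assume "B \<in> sets borel"
  with assms have "{\<gamma> \<in> configs. emeasure \<gamma> \<Lambda> \<in> B} \<in> sets config_space"
    unfolding config_space_def sets_measure_of[OF config_space_generators]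
    by (intro sigma_sets.Basic) blast
  moreover have "(\<lambda>\<gamma>. emeasure \<gamma> \<Lambda>) -` B \<inter> space config_space = {\<gamma> \<in> configs. emeasure \<gamma> \<Lambda> \<in> B}"
    by (auto simp: space_config_space)
  ultimately show "(\<lambda>\<gamma>. emeasure \<gamma> \<Lambda>) -` B \<inter> space config_space \<in> sets config_space" by simp
qed simp

lemma measurable_config_spaceI:
  assumes "\<And>\<omega>. \<omega> \<in> space M \<Longrightarrow> f \<omega> \<in> configs"
    and "\<And>A. A \<in> bounded_borel \<Longrightarrow> (\<lambda>\<omega>. emeasure (f \<omega>) A) \<in> borel_measurable M"
  shows "f \<in> measurable M config_space"
  unfolding config_space_def
proof (rule measurable_measure_of[OF config_space_generators])
  show "f \<in> space M \<rightarrow> configs" using assms(1) by auto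
  fix y :: "'b measure set"
  assume "y \<in> {{\<gamma> \<in> configs. emeasure \<gamma> \<Lambda> \<in> B} | \<Lambda> B. \<Lambda> \<in> bounded_borel \<and> B \<in> sets borel}"
  then obtain \<Lambda> and B :: "ennreal set"
    where y: "y = {\<gamma> \<in> configs. emeasure \<gamma> \<Lambda> \<in> B}" "\<Lambda> \<in> bounded_borel" "B \<in> sets borel" by blast
  have "f -` y \<inter> space M = (\<lambda>\<omega>. emeasure (f \<omega>) \<Lambda>) -` B \<inter> space M"
    using assms(1) by (auto simp: y(1))
  then show "f -` y \<inter> space M \<in> sets M" using measurable_sets[OF assms(2)[OF y(2)] y(3)] by simp
qed

text \<open>With the outside configuration frozen, every count of the glued configuration is a count
  of \<open>\<gamma>'\<close> plus a constant.\<close>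

lemma measurable_glue:
  assumes "\<gamma> \<in> configs" "\<Lambda> \<in> bounded_borel" "sets P = sets config_space"
  shows "(\<lambda>\<gamma>'. glue \<Lambda> \<gamma>' \<gamma>) \<in> measurable P config_space"
proof (rule measurable_config_spaceI)
  have sp: "space P = configs" using assms(3) space_config_space by (metis sets_eq_imp_space_eq)
  show "glue \<Lambda> \<gamma>' \<gamma> \<in> configs" if "\<gamma>' \<in> space P" for \<gamma>'
    using glue_in_configs[OF assms(1) _ bounded_borelD(1)[OF assms(2)]] that sp by simp
  fix A :: "'a set" assume A: "A \<in> bounded_borel"
  have AL: "A \<inter> \<Lambda> \<in> bounded_borel" by (rule bounded_borel_Int[OF assms(2) bounded_borelD(1)[OF A]])
  have "(\<lambda>\<gamma>'. emeasure \<gamma>' (A \<inter> \<Lambda>)) \<in> borel_measurable P"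
    using measurable_emeasure_config[OF AL] measurable_cong_sets[OF assms(3) refl] by blast
  then have "(\<lambda>\<gamma>'. emeasure \<gamma>' (A \<inter> \<Lambda>) + emeasure \<gamma> (A - \<Lambda>)) \<in> borel_measurable P" by simp
  then show "(\<lambda>\<gamma>'. emeasure (glue \<Lambda> \<gamma>' \<gamma>) A) \<in> borel_measurable P"
    by (rule measurable_cong[THEN iffD1, rotated])
       (simp add: sp emeasure_glue[OF assms(1) _ bounded_borelD(1)[OF assms(2)] bounded_borelD(1)[OF A]])
qed

section \<open>Energies and local energies\<close>

text \<open>Half-open like the intervals of the step interaction: consecutive shells are disjoint,
  and shells of shrinking thickness with a fixed inner radius decrease to the empty set.\<close>

definition shell :: "'v::euclidean_space \<Rightarrow> real \<Rightarrow> real \<Rightarrow> 'v set" where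
  "shell x a b = {y. a < dist x y \<and> dist x y \<le> b}"

lemma shell_bounded_borel [simp]: "shell x a b \<in> bounded_borel"
proof (rule bounded_borel_subset[of "cball x b"])
  have "shell x a b = cball x b - cball x a" by (auto simp: shell_def)
  then show "shell x a b \<in> sets borel" by simp
qed (auto simp: shell_def)

lemma diameter_doubleton: "diameter {x, y} = dist x (y :: 'v::real_normed_vector)"
proof (rule antisym)
  show "diameter {x, y} \<le> dist x y"
    by (rule diameter_le) (auto simp: dist_norm norm_minus_commute)
  show "dist x y \<le> diameter {x, y}"
    by (rule diameter_bounded_bound) (auto intro: finite_imp_bounded)
qed

lemma sum_ereal_neq_minf: "(\<And>e. e \<in> A \<Longrightarrow> f e \<noteq> - \<infinity>) \<Longrightarrow> (\<Sum>e\<in>A. f e :: ereal) \<noteq> - \<infinity>"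
  by (induction A rule: infinite_finite_induct) auto

lemma sum_ereal_eq_pinf:
  assumes "finite A" "\<And>e. e \<in> A \<Longrightarrow> f e \<noteq> - \<infinity>"
  shows "(\<Sum>e\<in>A. f e :: ereal) = \<infinity> \<longleftrightarrow> (\<exists>e\<in>A. f e = \<infinity>)"
  using assms by (auto simp: sum_Pinfty)

lemma step_interaction_neq_minf: "step_interaction p r \<alpha> \<theta> t \<noteq> - \<infinity>"
  by (auto simp: step_interaction_def split: split_indicator)

lemma step_interaction_eq_pinf_iff:
  "step_interaction p r \<alpha> \<theta> t = \<infinity> \<longleftrightarrow> t \<in> {0..1/\<alpha>}"
  by (auto simp: step_interaction_def split: split_indicator)

lemma step_interaction_outside_core:
  "t \<notin> {0..1/\<alpha>} \<Longrightarrow> step_interaction p r \<alpha> \<theta> t =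
    ereal (\<Sum>i=1..p. \<theta> i * indicator {1/\<alpha> + r (i - 1) <.. 1/\<alpha> + r i} t)"
  by (auto simp: step_interaction_def split: split_indicator)

text \<open>Takes a set of points instead of a measure, so that adding a point to a configuration
  becomes \<open>insert\<close>.\<close>

definition interacting_pairs ::
    "nat \<Rightarrow> (nat \<Rightarrow> real) \<Rightarrow> real \<Rightarrow> (nat \<Rightarrow> real) \<Rightarrow> 'v::euclidean_space set \<Rightarrow> 'v set \<Rightarrow> 'v set set" where
  "interacting_pairs p r \<alpha> \<theta> \<Lambda> P =
     {e. e \<subseteq> P \<and> card e = 2 \<and> e \<inter> \<Lambda> \<noteq> {} \<and> step_interaction p r \<alpha> \<theta> (diameter e) \<noteq> 0}"

lemma step_energy_alt:
  "step_energy p r \<alpha> \<theta> \<Lambda> \<gamma> =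
     (\<Sum>e\<in>interacting_pairs p r \<alpha> \<theta> \<Lambda> (points \<gamma>). step_interaction p r \<alpha> \<theta> (diameter e))"
  by (simp add: step_energy_def interacting_pairs_def)

lemma step_energy_neq_minf: "step_energy p r \<alpha> \<theta> \<Lambda> \<gamma> \<noteq> - \<infinity>"
  unfolding step_energy_alt by (rule sum_ereal_neq_minf) (rule step_interaction_neq_minf)

text \<open>The inequality is strict because the interaction is infinite on a closed interval, and
  only one of the two points has to lie in \<Lambda>, as in the energy.\<close>

definition hard_core :: "real \<Rightarrow> 'v::metric_space set \<Rightarrow> 'v set \<Rightarrow> bool" where
  "hard_core c \<Lambda> P \<longleftrightarrow> (\<forall>x\<in>P \<inter> \<Lambda>. \<forall>y\<in>P. x \<noteq> y \<longrightarrow> c < dist x y)"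

text \<open>The closed form that the local energy at a point \<open>x\<close> outside
  \<open>P\<close> turns out to have. Its finite values are linear in \<theta> with shell counts as
  coefficients.\<close>

definition interaction_at ::
    "nat \<Rightarrow> (nat \<Rightarrow> real) \<Rightarrow> real \<Rightarrow> (nat \<Rightarrow> real) \<Rightarrow> 'v::euclidean_space \<Rightarrow> 'v set \<Rightarrow> ereal" where
  "interaction_at p r \<alpha> \<theta> x P =
     (if P \<inter> cball x (1/\<alpha>) = {}
      then ereal (\<Sum>i=1..p. \<theta> i * card (P \<inter> shell x (1/\<alpha> + r (i - 1)) (1/\<alpha> + r i)))
      else \<infinity>)"

section \<open>Finiteness of energies and the closed form of the local energy\<close>

locale step_ranges =
  fixes p :: nat and r :: "nat \<Rightarrow> real"
  assumes r_0: "r 0 = 0" and r_mono: "strict_mono_on {0..p} r"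
begin

lemma r_le: "i \<le> j \<Longrightarrow> j \<le> p \<Longrightarrow> r i \<le> r j"
  using strict_mono_on_leD[OF r_mono, of i j] by simp

lemma r_nonneg: "i \<le> p \<Longrightarrow> 0 \<le> r i"
  using r_le[of 0 i] r_0 by simp

lemma r_less: "1 \<le> i \<Longrightarrow> i \<le> p \<Longrightarrow> r (i - 1) < r i"
  using strict_mono_onD[OF r_mono, of "i - 1" i] by simp

lemma step_interaction_out_of_range:
  assumes "1/\<alpha> + r p < t" "0 < \<alpha>"
  shows "step_interaction p r \<alpha> \<theta> t = 0"
proof -
  have "0 \<le> r p" by (rule r_nonneg) simp
  then have "t \<notin> {0..1/\<alpha>}" using assms by simp
  moreover have "indicator {1/\<alpha> + r (i - 1) <.. 1/\<alpha> + r i} t = (0::real)" if "i \<in> {1..p}" for i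
    using r_le[of i p] that assms by (auto simp: indicator_def)
  ultimately show ?thesis by (simp add: step_interaction_outside_core zero_ereal_def)
qed

text \<open>An interacting pair is no longer than \<open>1/\<alpha> + r p\<close>, so one end in
  \<Lambda> confines both to a fixed larger ball with finitely many points. Without this the energy
  could be the default value of an infinite sum.\<close>

lemma finite_interacting_pairs:
  assumes P: "\<And>B. bounded B \<Longrightarrow> finite (P \<inter> B)" and \<Lambda>: "bounded \<Lambda>" and \<alpha>: "0 < \<alpha>"
  shows "finite (interacting_pairs p r \<alpha> \<theta> \<Lambda> P)"
proof -
  obtain b where b: "\<Lambda> \<subseteq> ball 0 b" using bounded_subset_ballD[OF \<Lambda>] by blast
  let ?Q = "P \<inter> cball 0 (b + (1/\<alpha> + r p))"
  have rp: "0 \<le> 1/\<alpha> + r p" using \<alpha> r_nonneg[of p] by simp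
  have "interacting_pairs p r \<alpha> \<theta> \<Lambda> P \<subseteq> Pow ?Q"
  proof (rule subsetI, rule PowI)
    fix e assume e: "e \<in> interacting_pairs p r \<alpha> \<theta> \<Lambda> P"
    then obtain u v where e2: "e = {u, v}" "u \<noteq> v"
      by (auto simp: interacting_pairs_def card_2_iff)
    then obtain x y where xy: "e = {x, y}" "x \<in> \<Lambda>"
      using e by (auto simp: interacting_pairs_def)
    have "\<not> 1/\<alpha> + r p < dist x y"
      using e step_interaction_out_of_range[of \<alpha> "dist x y" \<theta>] \<alpha>
      by (auto simp: xy(1) interacting_pairs_def diameter_doubleton)
    moreover have "norm x < b" using xy(2) b by auto
    moreover have "norm y \<le> norm x + dist x y"
      using norm_triangle_ineq2[of y x] by (simp add: dist_norm norm_minus_commute)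
    ultimately have "norm x \<le> b + (1/\<alpha> + r p)" "norm y \<le> b + (1/\<alpha> + r p)" using rp by linarith+
    then show "e \<subseteq> ?Q" using e by (auto simp: xy(1) interacting_pairs_def)
  qed
  moreover have "finite (Pow ?Q)" using P[OF bounded_cball] by (simp del: Pow_Int_eq)
  ultimately show ?thesis by (rule finite_subset)
qed

text \<open>A finite sum without negative infinite terms is infinite only through an infinite term,
  and only the hard core produces one. The right-hand side no longer mentions \<theta>, which is the
  source of (S1).\<close>

lemma step_energy_finite_iff:
  assumes "\<gamma> \<in> configs" "bounded \<Lambda>" "0 < \<alpha>"
  shows "step_energy p r \<alpha> \<theta> \<Lambda> \<gamma> < \<infinity> \<longleftrightarrow> hard_core (1/\<alpha>) \<Lambda> (points \<gamma>)"
proof -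
  have fin: "finite (interacting_pairs p r \<alpha> \<theta> \<Lambda> (points \<gamma>))"
    using assms by (intro finite_interacting_pairs finite_points)
  have "step_energy p r \<alpha> \<theta> \<Lambda> \<gamma> = \<infinity> \<longleftrightarrow>
      (\<exists>e\<in>interacting_pairs p r \<alpha> \<theta> \<Lambda> (points \<gamma>). step_interaction p r \<alpha> \<theta> (diameter e) = \<infinity>)"
    unfolding step_energy_alt by (rule sum_ereal_eq_pinf[OF fin step_interaction_neq_minf])
  also have "\<dots> \<longleftrightarrow> \<not> hard_core (1/\<alpha>) \<Lambda> (points \<gamma>)"
  proof
    assume "\<exists>e\<in>interacting_pairs p r \<alpha> \<theta> \<Lambda> (points \<gamma>). step_interaction p r \<alpha> \<theta> (diameter e) = \<infinity>"
    then obtain e where e: "e \<subseteq> points \<gamma>" "card e = 2" "e \<inter> \<Lambda> \<noteq> {}"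
        "step_interaction p r \<alpha> \<theta> (diameter e) = \<infinity>" by (auto simp: interacting_pairs_def)
    obtain u v where uv: "e = {u, v}" "u \<noteq> v" using e(2) by (auto simp: card_2_iff)
    then obtain x y where "e = {x, y}" "x \<noteq> y" "x \<in> \<Lambda>" using e(3) by auto
    with e show "\<not> hard_core (1/\<alpha>) \<Lambda> (points \<gamma>)"
      by (force simp: hard_core_def step_interaction_eq_pinf_iff diameter_doubleton)
  next
    assume "\<not> hard_core (1/\<alpha>) \<Lambda> (points \<gamma>)"
    then obtain x y where xy: "x \<in> points \<gamma>" "x \<in> \<Lambda>" "y \<in> points \<gamma>" "x \<noteq> y" "dist x y \<le> 1/\<alpha>"
      by (auto simp: hard_core_def not_less)
    then have "step_interaction p r \<alpha> \<theta> (diameter {x, y}) = \<infinity>"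
      by (simp add: step_interaction_eq_pinf_iff diameter_doubleton)
    with xy have "{x, y} \<in> interacting_pairs p r \<alpha> \<theta> \<Lambda> (points \<gamma>)"
      by (auto simp: interacting_pairs_def)
    with \<open>step_interaction p r \<alpha> \<theta> (diameter {x, y}) = \<infinity>\<close>
    show "\<exists>e\<in>interacting_pairs p r \<alpha> \<theta> \<Lambda> (points \<gamma>). step_interaction p r \<alpha> \<theta> (diameter e) = \<infinity>"
      by blast
  qed
  finally show ?thesis by (auto simp: less_top)
qed

text \<open>Outside the hard core the interaction is a weighted sum of indicators of shells;
  exchanging the sums over points and over steps turns it into shell counts.\<close>

lemma sum_step_interaction_eq_interaction_at:
  fixes x :: "'v::euclidean_space"
  assumes P: "\<And>B. bounded B \<Longrightarrow> finite (P \<inter> B)" and \<alpha>: "0 < \<alpha>"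
    and Q_def: "Q = {y \<in> P. step_interaction p r \<alpha> \<theta> (dist x y) \<noteq> 0}"
  shows "finite Q" "(\<Sum>y\<in>Q. step_interaction p r \<alpha> \<theta> (dist x y)) = interaction_at p r \<alpha> \<theta> x P"
proof -
  let ?\<phi> = "\<lambda>y. step_interaction p r \<alpha> \<theta> (dist x y)"
  let ?C = "P \<inter> cball x (1/\<alpha> + r p)"
  have finC: "finite ?C" using P[OF bounded_cball] .

  have QC: "Q \<subseteq> ?C"
    using step_interaction_out_of_range[OF _ \<alpha>, of _ \<theta>] by (force simp: Q_def)
  show finQ: "finite Q" using QC finC by (rule finite_subset)
  have rp: "0 \<le> r p" by (rule r_nonneg) simp
  show "(\<Sum>y\<in>Q. ?\<phi> y) = interaction_at p r \<alpha> \<theta> x P"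
  proof (cases "P \<inter> cball x (1/\<alpha>) = {}")
    case False
    then obtain y where y: "y \<in> P" "?\<phi> y = \<infinity>" by (auto simp: step_interaction_eq_pinf_iff)
    then have "y \<in> Q" by (simp add: Q_def)
    then have "(\<Sum>y\<in>Q. ?\<phi> y) = \<infinity>" using y(2)
      by (subst sum_ereal_eq_pinf[OF finQ]) (auto simp: step_interaction_neq_minf)
    then show ?thesis using False by (simp add: interaction_at_def)
  next
    case True
    \<comment> \<open>Adding the points in range that do not interact contributes zeros and gives an
      index set independent of \<theta>.\<close>
    have "(\<Sum>y\<in>Q. ?\<phi> y) = (\<Sum>y\<in>?C. ?\<phi> y)"
      by (rule sum.mono_neutral_left[OF finC QC]) (auto simp: Q_def)
    also have "\<dots> = (\<Sum>y\<in>?C. ereal (\<Sum>i=1..p. \<theta> i * indicator (shell x (1/\<alpha> + r (i - 1)) (1/\<alpha> + r i)) y))"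
    proof (rule sum.cong[OF refl])
      fix y assume "y \<in> ?C"
      then have "dist x y \<notin> {0..1/\<alpha>}" using True by auto
      then show "?\<phi> y = ereal (\<Sum>i=1..p. \<theta> i * indicator (shell x (1/\<alpha> + r (i - 1)) (1/\<alpha> + r i)) y)"
        by (auto simp: step_interaction_outside_core shell_def indicator_def intro!: sum.cong)
    qed
    also have "\<dots> = ereal (\<Sum>i=1..p. \<theta> i * (\<Sum>y\<in>?C. indicator (shell x (1/\<alpha> + r (i - 1)) (1/\<alpha> + r i)) y))"
      unfolding sum_ereal by (subst sum.swap) (simp add: sum_distrib_left)
    also have "\<dots> = ereal (\<Sum>i=1..p. \<theta> i * card (P \<inter> shell x (1/\<alpha> + r (i - 1)) (1/\<alpha> + r i)))"
    proof -
      have "(\<Sum>y\<in>?C. indicator (shell x (1/\<alpha> + r (i - 1)) (1/\<alpha> + r i)) y)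
          = real (card (P \<inter> shell x (1/\<alpha> + r (i - 1)) (1/\<alpha> + r i)))" if "i \<in> {1..p}" for i
      proof -
        have "?C \<inter> shell x (1/\<alpha> + r (i - 1)) (1/\<alpha> + r i) = P \<inter> shell x (1/\<alpha> + r (i - 1)) (1/\<alpha> + r i)"
          using r_le[of i p] that by (auto simp: shell_def)
        moreover have "(\<Sum>y\<in>?C. indicator (shell x (1/\<alpha> + r (i - 1)) (1/\<alpha> + r i)) y)
            = real (card (?C \<inter> {y. y \<in> shell x (1/\<alpha> + r (i - 1)) (1/\<alpha> + r i)}))"
          unfolding indicator_def by (rule sum_of_bool_eq) (rule finC)+
        ultimately show ?thesis by simp
      qed
      then show ?thesis by simp
    qed
    finally show ?thesis using True by (simp add: interaction_at_def)
  qed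
qed

lemma removable_add_point_iff:
  assumes \<gamma>: "\<gamma> \<in> configs" and \<alpha>: "0 < \<alpha>"
  shows "x \<in> removable (step_energy p r \<alpha> \<theta>) (add_point \<gamma> x) \<longleftrightarrow> x \<notin> points \<gamma>"
proof
  assume "x \<in> removable (step_energy p r \<alpha> \<theta>) (add_point \<gamma> x)"
  then show "x \<notin> points \<gamma>" using add_point_in_configs_iff[OF \<gamma>] by (simp add: removable_def)
next
  assume x: "x \<notin> points \<gamma>"
  \<comment> \<open>The hard-core condition on \<open>{x}\<close> is vacuous, as \<gamma> has no
    point there.\<close>
  then have "step_energy p r \<alpha> \<theta> {x} \<gamma> < \<infinity>"
    using step_energy_finite_iff[OF \<gamma> _ \<alpha>, of "{x}" \<theta>] by (auto simp: hard_core_def)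
  then show "x \<in> removable (step_energy p r \<alpha> \<theta>) (add_point \<gamma> x)"
    using x by (auto simp: removable_def points_add_point[OF \<gamma>] add_point_in_configs_iff[OF \<gamma>]
        del_point_add_point[OF \<gamma>] intro!: bexI[of _ "{x}"])
qed

text \<open>The pairs gained are those containing \<open>x\<close>, and all of them meet \<Lambda>
  because \<open>x\<close> does.\<close>

lemma step_energy_add_point:
  assumes \<gamma>: "\<gamma> \<in> configs" and \<alpha>: "0 < \<alpha>" and x: "x \<notin> points \<gamma>" and \<Lambda>: "bounded \<Lambda>" "x \<in> \<Lambda>"
  shows "step_energy p r \<alpha> \<theta> \<Lambda> (add_point \<gamma> x) =
    step_energy p r \<alpha> \<theta> \<Lambda> \<gamma> + interaction_at p r \<alpha> \<theta> x (points \<gamma>)"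
proof -
  let ?P = "points \<gamma>"
  let ?I = "interacting_pairs p r \<alpha> \<theta> \<Lambda>"
  let ?f = "\<lambda>e. step_interaction p r \<alpha> \<theta> (diameter e)"
  let ?Q = "{y \<in> ?P. step_interaction p r \<alpha> \<theta> (dist x y) \<noteq> 0}"
  note Q = sum_step_interaction_eq_interaction_at[OF finite_points[OF \<gamma>] \<alpha> refl, of \<theta> x]
  have split: "?I (insert x ?P) = ?I ?P \<union> (\<lambda>y. {x, y}) ` ?Q"
  proof (rule set_eqI, rule iffI)
    fix e assume e: "e \<in> ?I (insert x ?P)"
    show "e \<in> ?I ?P \<union> (\<lambda>y. {x, y}) ` ?Q"
    proof (cases "x \<in> e")
      case True
      then obtain y where y: "e = {x, y}" "x \<noteq> y"
        using e by (auto simp: interacting_pairs_def card_2_iff)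
      then show ?thesis using e by (auto simp: interacting_pairs_def diameter_doubleton)
    qed (use e in \<open>auto simp: interacting_pairs_def\<close>)
  next
    fix e assume "e \<in> ?I ?P \<union> (\<lambda>y. {x, y}) ` ?Q"
    then show "e \<in> ?I (insert x ?P)"
    proof
      assume "e \<in> (\<lambda>y. {x, y}) ` ?Q"
      then obtain y where y: "y \<in> ?Q" "e = {x, y}" by blast
      with x have "x \<noteq> y" by auto
      with y \<Lambda>(2) show ?thesis by (auto simp: interacting_pairs_def diameter_doubleton)
    qed (auto simp: interacting_pairs_def)
  qed
  have disj: "?I ?P \<inter> (\<lambda>y. {x, y}) ` ?Q = {}" using x by (auto simp: interacting_pairs_def)
  have "inj_on (\<lambda>y. {x, y}) ?Q" by (auto simp: inj_on_def doubleton_eq_iff)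
  then have "(\<Sum>e\<in>(\<lambda>y. {x, y}) ` ?Q. ?f e) = interaction_at p r \<alpha> \<theta> x ?P"
    by (simp add: sum.reindex diameter_doubleton Q(2))
  moreover have "finite (?I ?P)" by (rule finite_interacting_pairs[OF finite_points[OF \<gamma>] \<Lambda>(1) \<alpha>])
  ultimately show ?thesis
    unfolding step_energy_alt points_add_point[OF \<gamma>] split
    using disj Q(1) by (subst sum.union_disjoint) auto
qed

text \<open>Whatever \<Lambda> is chosen, the energy before adding \<open>x\<close> is real and
  cancels, even when the energy afterwards is infinite.\<close>

lemma local_energy_eq_interaction_at:
  assumes \<gamma>: "\<gamma> \<in> configs" and \<alpha>: "0 < \<alpha>" and x: "x \<notin> points \<gamma>"
  shows "local_energy (step_energy p r \<alpha> \<theta>) x \<gamma> = interaction_at p r \<alpha> \<theta> x (points \<gamma>)"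
proof -
  let ?H = "step_energy p r \<alpha> \<theta>"
  define \<Lambda> where "\<Lambda> = (SOME \<Lambda>. \<Lambda> \<in> bounded_borel \<and> x \<in> \<Lambda> \<and> ?H \<Lambda> \<gamma> < \<infinity>)"
  have rem: "x \<in> removable ?H (add_point \<gamma> x)" using x removable_add_point_iff[OF \<gamma> \<alpha>] by blast
  then have "\<exists>\<Lambda>. \<Lambda> \<in> bounded_borel \<and> x \<in> \<Lambda> \<and> ?H \<Lambda> \<gamma> < \<infinity>"
    by (auto simp: removable_def del_point_add_point[OF \<gamma>])
  from someI_ex[OF this] have \<Lambda>: "\<Lambda> \<in> bounded_borel" "x \<in> \<Lambda>" "?H \<Lambda> \<gamma> < \<infinity>"
    unfolding \<Lambda>_def by simp_all
  have "local_energy ?H x \<gamma> = ?H \<Lambda> (add_point \<gamma> x) - ?H \<Lambda> \<gamma>"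
    using rem unfolding local_energy_def \<Lambda>_def Let_def by simp
  also have "\<dots> = interaction_at p r \<alpha> \<theta> x (points \<gamma>)"
    using step_energy_add_point[OF \<gamma> \<alpha> x bounded_borelD(2)[OF \<Lambda>(1)] \<Lambda>(2), of \<theta>]
      \<Lambda>(3) step_energy_neq_minf[of p r \<alpha> \<theta> \<Lambda> \<gamma>]
    by (cases "?H \<Lambda> \<gamma>"; cases "interaction_at p r \<alpha> \<theta> x (points \<gamma>)") auto
  finally show ?thesis .
qed

text \<open>The default is one and the same constant for all such \<gamma>, so it does not disturb
  measurability.\<close>

lemma local_energy_not_removable:
  assumes "\<gamma> \<in> configs" "0 < \<alpha>" "x \<in> points \<gamma>"
  shows "local_energy (step_energy p r \<alpha> \<theta>) x \<gamma> = undefined"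
  using assms by (simp add: local_energy_def removable_add_point_iff)

end

section \<open>Measurability\<close>

lemma measurable_card_points [measurable]:
  assumes "B \<in> bounded_borel"
  shows "(\<lambda>\<gamma>. real (card (points \<gamma> \<inter> B))) \<in> borel_measurable config_space"
proof -
  have "(\<lambda>\<gamma>. enn2real (emeasure \<gamma> B)) \<in> borel_measurable config_space"
    using measurable_emeasure_config[OF assms] by simp
  then show ?thesis
    by (rule measurable_cong[THEN iffD1, rotated])
       (simp add: space_config_space enn2real_emeasure_configs[OF _ assms])
qed

lemma sets_no_points [measurable]:
  assumes "B \<in> bounded_borel"
  shows "{\<gamma> \<in> space config_space. points \<gamma> \<inter> B = {}} \<in> sets config_space"
proof -
  have "{\<gamma> \<in> space config_space. emeasure \<gamma> B = 0} \<in> sets config_space"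
    using measurable_emeasure_config[OF assms] by measurable
  also have "{\<gamma> \<in> space config_space. emeasure \<gamma> B = 0} = {\<gamma> \<in> space config_space. points \<gamma> \<inter> B = {}}"
    using emeasure_configs_eq_0_iff[OF _ assms] by (auto simp: space_config_space)
  finally show ?thesis .
qed

lemma sets_some_point:
  assumes "B \<in> bounded_borel"
  shows "{\<gamma> \<in> space config_space. points \<gamma> \<inter> B \<noteq> {}} \<in> sets config_space"
  using sets_no_points[OF assms] by (rule sets.sets_Collect_neg)

lemma measurable_interaction_at:
  "(\<lambda>\<gamma>. interaction_at p r \<alpha> \<theta> x (points \<gamma>)) \<in> borel_measurable config_space"
  unfolding interaction_at_def
  by (intro measurable_If sets_no_points borel_measurable_ereal borel_measurable_sum
      borel_measurable_times borel_measurable_const measurable_card_points) simp_all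

lemma (in step_ranges) measurable_local_energy:
  assumes "0 < \<alpha>"
  shows "local_energy (step_energy p r \<alpha> \<theta>) x \<in> borel_measurable config_space"
proof -
  have "(\<lambda>\<gamma>. if points \<gamma> \<inter> {x} = {} then interaction_at p r \<alpha> \<theta> x (points \<gamma>) else undefined)
      \<in> borel_measurable config_space"
    by (intro measurable_If sets_no_points measurable_interaction_at) simp_all
  then show ?thesis
    by (rule measurable_cong[THEN iffD1, rotated])
       (auto simp: space_config_space local_energy_eq_interaction_at local_energy_not_removable assms)
qed

section \<open>Measurability of the hard-core event\<close>

lemma quadrilateral_ineq: "dist a d \<le> dist a b + dist b c + dist c (d :: 'v::metric_space)"
  using dist_triangle[of a d b] dist_triangle[of b d c] by linarith

text \<open>The two conditions on the centres guarantee that any points of the two balls are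
  distinct and closer than \<open>c\<close>, so they mention the balls only.\<close>

lemma ex_separating_balls:
  fixes x y :: "'v::euclidean_space"
  assumes D: "\<And>U. open U \<Longrightarrow> U \<noteq> {} \<Longrightarrow> \<exists>d\<in>D. d \<in> U" and xy: "x \<noteq> y" "dist x y < c"
  obtains q q' n where "q \<in> D" "q' \<in> D" "x \<in> ball q (1/Suc n)" "y \<in> ball q' (1/Suc n)"
    "2 * (1 / Suc n) \<le> dist q q'" "dist q q' + 2 * (1 / Suc n) < c"
proof -
  \<comment> \<open>A quarter, because each condition loses four radii: two for passing from
    \<open>x\<close>, \<open>y\<close> to the centres and two that it contains itself.\<close>
  define e where "e = min (dist x y) (c - dist x y) / 4"
  have "0 < e" using xy by (simp add: e_def)
  then obtain n where n: "1 / real (Suc n) < e" using nat_approx_posE by blast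
  have "\<exists>d\<in>D. d \<in> ball z (1/Suc n)" for z by (rule D) auto
  then obtain q q' where q: "q \<in> D" "q' \<in> D" "dist x q < 1/Suc n" "dist y q' < 1/Suc n"
    by (meson mem_ball)
  have e4: "4 * e \<le> dist x y" "4 * e \<le> c - dist x y" by (simp_all add: e_def)
  have "dist x y \<le> dist x q + dist q q' + dist q' y" "dist q q' \<le> dist q x + dist x y + dist y q'"
    by (rule quadrilateral_ineq)+
  then have "2 * (1 / Suc n) \<le> dist q q'" "dist q q' + 2 * (1 / Suc n) < c"
    using q(3,4) n e4 dist_commute[of q x] dist_commute[of q' y] by linarith+
  with q show thesis by (intro that[of q q' n]) (auto simp: dist_commute)
qed

text \<open>Being distinct and closer than \<open>c\<close> is an open condition, so it is witnessed
  by one of countably many pairs of disjoint balls with centres in a dense set; that a ball is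
  occupied is an event about counts.\<close>

lemma sets_close_pair:
  fixes \<Lambda> :: "'v::euclidean_space set"
  assumes \<Lambda>: "\<Lambda> \<in> bounded_borel"
  shows "{\<gamma> \<in> space config_space. \<exists>x\<in>points \<gamma> \<inter> \<Lambda>. \<exists>y\<in>points \<gamma>. x \<noteq> y \<and> dist x y < c} \<in> sets config_space"
proof -
  obtain D :: "'v set" where D: "countable D" "\<And>U. open U \<Longrightarrow> U \<noteq> {} \<Longrightarrow> \<exists>d\<in>D. d \<in> U"
    using countable_dense_setE by blast
  define I where "I = {(q, q', n). q \<in> D \<and> q' \<in> D \<and> 2 * (1 / Suc n) \<le> dist q q' \<and> dist q q' + 2 * (1 / Suc n) < c}"
  have cI: "countable I"
    by (rule countable_subset[of _ "D \<times> D \<times> (UNIV :: nat set)"]) (use D(1) in \<open>auto simp: I_def\<close>)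
  let ?A = "\<lambda>(q, q', n::nat). {\<gamma> \<in> space config_space. points \<gamma> \<inter> (ball q (1/Suc n) \<inter> \<Lambda>) \<noteq> {}} \<inter>
      {\<gamma> \<in> space config_space. points \<gamma> \<inter> ball q' (1/Suc n) \<noteq> {}}"
  have "(\<Union>i\<in>I. ?A i) \<in> sets config_space"
    by (rule sets.countable_UN'[OF cI])
       (auto intro!: sets.Int sets_some_point bounded_borel_Int[OF \<Lambda>] simp del: Int_iff)
  also have "(\<Union>i\<in>I. ?A i) = {\<gamma> \<in> space config_space. \<exists>x\<in>points \<gamma> \<inter> \<Lambda>. \<exists>y\<in>points \<gamma>. x \<noteq> y \<and> dist x y < c}"
  proof (intro equalityI subsetI)
    fix \<gamma> assume "\<gamma> \<in> (\<Union>i\<in>I. ?A i)"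
    then obtain q q' n x y where *: "(q, q', n) \<in> I" "\<gamma> \<in> space config_space"
        "x \<in> points \<gamma>" "x \<in> \<Lambda>" "dist q x < 1/Suc n" "y \<in> points \<gamma>" "dist q' y < 1/Suc n" by auto
    have "dist q q' \<le> dist q x + dist x y + dist y q'" "dist x y \<le> dist x q + dist q q' + dist q' y"
      by (rule quadrilateral_ineq)+
    moreover have "2 * (1 / Suc n) \<le> dist q q'" "dist q q' + 2 * (1 / Suc n) < c"
      using *(1) by (simp_all add: I_def)
    ultimately have "0 < dist x y" "dist x y < c"
      using *(5,7) dist_commute[of q x] dist_commute[of q' y] by linarith+
    then show "\<gamma> \<in> {\<gamma> \<in> space config_space. \<exists>x\<in>points \<gamma> \<inter> \<Lambda>. \<exists>y\<in>points \<gamma>. x \<noteq> y \<and> dist x y < c}"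
      using * by auto
  next
    fix \<gamma> assume "\<gamma> \<in> {\<gamma> \<in> space config_space. \<exists>x\<in>points \<gamma> \<inter> \<Lambda>. \<exists>y\<in>points \<gamma>. x \<noteq> y \<and> dist x y < c}"
    then obtain x y where *: "\<gamma> \<in> space config_space" "x \<in> points \<gamma>" "x \<in> \<Lambda>" "y \<in> points \<gamma>" "x \<noteq> y" "dist x y < c"
      by auto
    obtain q q' n where "q \<in> D" "q' \<in> D" "x \<in> ball q (1/Suc n)" "y \<in> ball q' (1/Suc n)"
        "2 * (1 / Suc n) \<le> dist q q'" "dist q q' + 2 * (1 / Suc n) < c"
      by (rule ex_separating_balls[OF D(2) *(5,6)])
    then show "\<gamma> \<in> (\<Union>i\<in>I. ?A i)"
      using * by (intro UN_I[of "(q, q', n)"]) (auto simp: I_def)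
  qed
  finally show ?thesis .
qed

text \<open>Local finiteness makes the gap between \<open>c\<close> and the distances exceeding it positive.\<close>

lemma hard_core_gap:
  assumes \<gamma>: "\<gamma> \<in> configs" and \<Lambda>: "bounded \<Lambda>" and hc: "hard_core c \<Lambda> (points \<gamma>)"
  obtains c' where "c < c'" "hard_core c' \<Lambda> (points \<gamma>)"
proof -
  obtain b where b: "\<Lambda> \<subseteq> ball 0 b" using bounded_subset_ballD[OF \<Lambda>] by blast
  let ?Q = "points \<gamma> \<inter> cball 0 (b + \<bar>c\<bar> + 1)"
  let ?D = "{t \<in> (\<lambda>(x, y). dist x y) ` (?Q \<times> ?Q). c < t}"
  \<comment> \<open>Halfway to the next distance that occurs; \<open>c + 1\<close> keeps the set
    nonempty, and \<open>?Q\<close> is large enough to contain every pair meeting \<Lambda> with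
    distance at most \<open>c + 1\<close>.\<close>
  define c' where "c' = (c + Min (insert (c + 1) ?D)) / 2"
  have fin: "finite ?D" using finite_points[OF \<gamma>, of "cball 0 (b + \<bar>c\<bar> + 1)"] by auto
  have cM: "c < Min (insert (c + 1) ?D)" using fin by (subst Min_gr_iff) auto
  then have c': "c < c'" "c' < Min (insert (c + 1) ?D)" by (simp_all add: c'_def)
  have "c' < dist x y" if xy: "x \<in> points \<gamma>" "x \<in> \<Lambda>" "y \<in> points \<gamma>" "x \<noteq> y" for x y
  proof (cases "dist x y \<le> c + 1")
    case True
    have "norm x < b" using xy(2) b by auto
    moreover have "norm y \<le> norm x + dist x y"
      using norm_triangle_ineq2[of y x] by (simp add: dist_norm norm_minus_commute)
    ultimately have "norm x \<le> b + \<bar>c\<bar> + 1" "norm y \<le> b + \<bar>c\<bar> + 1" using True by linarith+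
    then have "x \<in> ?Q" "y \<in> ?Q" using xy by auto
    moreover have "c < dist x y" using hc xy by (auto simp: hard_core_def)
    ultimately have "dist x y \<in> ?D" by force
    then have "Min (insert (c + 1) ?D) \<le> dist x y" using fin by (intro Min_le) auto
    then show ?thesis using c'(2) by linarith
  next
    case False
    have "Min (insert (c + 1) ?D) \<le> c + 1" using fin by (intro Min_le) auto
    then show ?thesis using c'(2) False by linarith
  qed
  then show thesis using c'(1) by (intro that[of c']) (auto simp: hard_core_def)
qed

text \<open>A violation is a distance at most \<open>c\<close>, which is not open. Because of the
  gap, the hard core holds exactly if for some \<open>n\<close> no pair is closer than
  \<open>c + 1 / Suc n\<close>.\<close>

lemma sets_hard_core:
  assumes \<Lambda>: "\<Lambda> \<in> bounded_borel"
  shows "{\<gamma> \<in> space config_space. hard_core c \<Lambda> (points \<gamma>)} \<in> sets config_space"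
proof -
  let ?E = "\<lambda>c. {\<gamma> \<in> space config_space. \<exists>x\<in>points \<gamma> \<inter> \<Lambda>. \<exists>y\<in>points \<gamma>. x \<noteq> y \<and> dist x y < c}"
  have "(\<Union>n. space config_space - ?E (c + 1 / Suc n)) \<in> sets config_space"
    using sets_close_pair[OF \<Lambda>] by auto
  also have "(\<Union>n. space config_space - ?E (c + 1 / Suc n)) = {\<gamma> \<in> space config_space. hard_core c \<Lambda> (points \<gamma>)}"
  proof (intro equalityI subsetI)
    fix \<gamma> assume "\<gamma> \<in> (\<Union>n. space config_space - ?E (c + 1 / Suc n))"
    then obtain n where n: "\<gamma> \<in> space config_space"
        "\<forall>x\<in>points \<gamma> \<inter> \<Lambda>. \<forall>y\<in>points \<gamma>. x \<noteq> y \<longrightarrow> c + 1 / Suc n \<le> dist x y" by (auto simp: not_less)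
    have "c < c + 1 / Suc n" by simp
    with n show "\<gamma> \<in> {\<gamma> \<in> space config_space. hard_core c \<Lambda> (points \<gamma>)}"
      unfolding hard_core_def by (blast intro: less_le_trans)
  next
    fix \<gamma> assume \<gamma>: "\<gamma> \<in> {\<gamma> \<in> space config_space. hard_core c \<Lambda> (points \<gamma>)}"
    then obtain c' where c': "c < c'" "hard_core c' \<Lambda> (points \<gamma>)"
      using hard_core_gap[OF _ bounded_borelD(2)[OF \<Lambda>]] by (auto simp: space_config_space)
    then obtain n where "1 / real (Suc n) < c' - c" using nat_approx_posE[of "c' - c"] by auto
    then have "\<gamma> \<notin> ?E (c + 1 / Suc n)" using c'(2) by (force simp: hard_core_def)
    then show "\<gamma> \<in> (\<Union>n. space config_space - ?E (c + 1 / Suc n))" using \<gamma> by blast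
  qed
  finally show ?thesis .
qed

text \<open>Pigeonhole: a ball of radius \<open>a/2\<close> holds at most one of the separated
  points. The finite cover is chosen around the origin and carried along by translation, so
  \<open>N\<close> does not depend on \<open>x\<close>.\<close>

lemma packing_bound:
  fixes a R :: real
  assumes a: "0 < a"
  obtains N :: nat where "\<And>x (P :: 'v::euclidean_space set).
    (\<And>y z. y \<in> P \<inter> cball x R \<Longrightarrow> z \<in> P \<inter> cball x R \<Longrightarrow> y \<noteq> z \<Longrightarrow> a < dist y z) \<Longrightarrow> card (P \<inter> cball x R) \<le> N"
proof -
  have cover: "cball 0 R \<subseteq> (\<Union>k::'v. ball k (a/2))"
  proof
    fix y :: 'v
    have "y \<in> ball y (a/2)" using a by simp
    then show "y \<in> (\<Union>k. ball k (a/2))" by blast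
  qed
  obtain F :: "'v set" where F: "finite F" "cball 0 R \<subseteq> (\<Union>k\<in>F. ball k (a/2))"
    by (rule compactE_image[OF compact_cball _ cover]) auto
  have "card (P \<inter> cball x R) \<le> card F"
    if sep: "\<And>y z. y \<in> P \<inter> cball x R \<Longrightarrow> z \<in> P \<inter> cball x R \<Longrightarrow> y \<noteq> z \<Longrightarrow> a < dist y z" for x :: 'v and P
  proof -
    have "\<exists>k\<in>F. dist k (y - x) < a/2" if "y \<in> cball x R" for y
    proof -
      have "y - x \<in> cball 0 R" using that by (simp add: dist_norm norm_minus_commute)
      then have "y - x \<in> (\<Union>k\<in>F. ball k (a/2))" using F(2) by blast
      then show ?thesis by auto
    qed
    then obtain k where k: "\<And>y. y \<in> cball x R \<Longrightarrow> k y \<in> F \<and> dist (k y) (y - x) < a/2"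
      using bchoice[of "cball x R" "\<lambda>y k. k \<in> F \<and> dist k (y - x) < a/2"] by blast
    have "inj_on k (P \<inter> cball x R)"
    proof (rule inj_onI, rule ccontr)
      fix y z assume yz: "y \<in> P \<inter> cball x R" "z \<in> P \<inter> cball x R" "k y = k z" "y \<noteq> z"
      have "dist y z = dist (y - x) (z - x)" by (simp add: dist_norm)
      also have "\<dots> \<le> dist (k y) (y - x) + dist (k z) (z - x)"
        using dist_triangle3[of "y - x" "z - x" "k y"] yz(3) by simp
      also have "\<dots> < a" using k[of y] k[of z] yz(1,2) by auto
      finally show False using sep[OF yz(1,2,4)] by simp
    qed
    then show ?thesis by (rule card_inj_on_le[OF _ _ F(1)]) (use k in auto)
  qed
  then show thesis by (rule that)
qed

section \<open>Gibbs measures\<close>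

text \<open>The DLR density with respect to the Poisson process. If the partition function is 0 or
  infinite, \<open>enn2real\<close> and division by zero make it vanish.\<close>

definition gibbs_weight ::
    "'v::euclidean_space measure measure \<Rightarrow> 'v energy \<Rightarrow> 'v set \<Rightarrow> 'v measure \<Rightarrow> 'v measure \<Rightarrow> real" where
  "gibbs_weight P H \<Lambda> \<gamma> \<gamma>' = boltzmann (H \<Lambda> (glue \<Lambda> \<gamma>' \<gamma>)) / enn2real (partition_function P H \<Lambda> \<gamma>)"

lemma boltzmann_nonneg: "0 \<le> boltzmann u"
  by (simp add: boltzmann_def)

lemma gibbs_weight_nonneg: "0 \<le> gibbs_weight P H \<Lambda> \<gamma> \<gamma>'"
  by (simp add: gibbs_weight_def boltzmann_nonneg)

lemma gibbs_measureD:
  assumes "gibbs_measure \<pi> H \<mu>"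
  shows "prob_space \<mu>" "sets \<mu> = sets config_space" "space \<mu> = configs"
  using assms sets_eq_imp_space_eq[of \<mu> config_space]
  by (auto simp: gibbs_measure_def space_config_space)

lemma poisson_processD:
  assumes "poisson_process \<nu> P"
  shows "prob_space P" "sets P = sets config_space" "space P = configs"
  using assms sets_eq_imp_space_eq[of P config_space]
  by (auto simp: poisson_process_def space_config_space)

lemma gibbs_dlr:
  assumes "gibbs_measure \<pi> H \<mu>" "\<Lambda> \<in> bounded_borel"
    "f \<in> borel_measurable config_space" "bounded (f ` configs)"
  shows "(\<integral>\<gamma>. f \<gamma> \<partial>\<mu>) = (\<integral>\<gamma>. (\<integral>\<gamma>'. f (glue \<Lambda> \<gamma>' \<gamma>) * gibbs_weight (\<pi> \<Lambda>) H \<Lambda> \<gamma> \<gamma>' \<partial>\<pi> \<Lambda>) \<partial>\<mu>)"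
  using assms unfolding gibbs_measure_def gibbs_weight_def by blast

lemma gibbs_dlr_indicator:
  assumes \<mu>: "gibbs_measure \<pi> H \<mu>" and \<Lambda>: "\<Lambda> \<in> bounded_borel" and E: "E \<in> sets config_space"
  shows "measure \<mu> E =
    (\<integral>\<gamma>. (\<integral>\<gamma>'. indicator E (glue \<Lambda> \<gamma>' \<gamma>) * gibbs_weight (\<pi> \<Lambda>) H \<Lambda> \<gamma> \<gamma>' \<partial>\<pi> \<Lambda>) \<partial>\<mu>)"
proof -
  interpret prob_space \<mu> by (rule gibbs_measureD[OF \<mu>])
  have "E \<subseteq> space \<mu>" using E gibbs_measureD(2)[OF \<mu>] sets.sets_into_space by blast
  then have "measure \<mu> E = (\<integral>\<gamma>. indicator E \<gamma> \<partial>\<mu>)"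
    by (simp add: Int_absorb1[of E] Int_commute[of E])
  moreover have "bounded ((indicator E :: _ \<Rightarrow> real) ` configs)"
    by (rule boundedI[of _ 1]) (auto simp: indicator_def)
  ultimately show ?thesis using gibbs_dlr[OF \<mu> \<Lambda>, of "indicator E"] E by simp
qed

text \<open>Almost everywhere either the indicator or the Boltzmann factor is 0, so the inner
  integral vanishes; this needs no measurability of the weight.\<close>

lemma gibbs_AE_not_in:
  assumes \<mu>: "gibbs_measure \<pi> H \<mu>" and \<Lambda>: "\<Lambda> \<in> bounded_borel" and E: "E \<in> sets config_space"
    and null: "\<And>\<gamma>. \<gamma> \<in> configs \<Longrightarrow> AE \<gamma>' in \<pi> \<Lambda>. glue \<Lambda> \<gamma>' \<gamma> \<in> E \<longrightarrow> H \<Lambda> (glue \<Lambda> \<gamma>' \<gamma>) = \<infinity>"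
  shows "AE \<gamma> in \<mu>. \<gamma> \<notin> E"
proof -
  interpret prob_space \<mu> by (rule gibbs_measureD[OF \<mu>])
  have "(\<integral>\<gamma>'. indicator E (glue \<Lambda> \<gamma>' \<gamma>) * gibbs_weight (\<pi> \<Lambda>) H \<Lambda> \<gamma> \<gamma>' \<partial>\<pi> \<Lambda>) = 0"
    if "\<gamma> \<in> configs" for \<gamma>
    by (rule integral_eq_zero_AE)
       (use null[OF that] in eventually_elim, auto simp: gibbs_weight_def boltzmann_def indicator_def)
  then have "measure \<mu> E = 0"
    unfolding gibbs_dlr_indicator[OF \<mu> \<Lambda> E]
    by (subst Bochner_Integration.integral_cong[OF refl, of _ _ "\<lambda>_. 0"]) (auto simp: gibbs_measureD(3)[OF \<mu>])
  moreover have "E \<in> sets \<mu>" using E gibbs_measureD(2)[OF \<mu>] by simp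
  ultimately have "E \<in> null_sets \<mu>" by (simp add: null_sets_def emeasure_eq_measure)
  then show ?thesis by (rule AE_not_in)
qed

text \<open>Neither the Boltzmann factor nor the inner integral of the DLR equation is known to be
  measurable, but a Bochner integral that fails to exist is \<open>0\<close>; as the DLR equation for the
  constant \<open>1\<close> has the value \<open>1\<close>, both have to be integrable.\<close>

lemma gibbs_weight_integral_1:
  assumes \<mu>: "gibbs_measure \<pi> H \<mu>" and \<Lambda>: "\<Lambda> \<in> bounded_borel"
  shows "AE \<gamma> in \<mu>. integrable (\<pi> \<Lambda>) (gibbs_weight (\<pi> \<Lambda>) H \<Lambda> \<gamma>) \<and>
    (\<integral>\<gamma>'. gibbs_weight (\<pi> \<Lambda>) H \<Lambda> \<gamma> \<gamma>' \<partial>\<pi> \<Lambda>) = 1"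
proof -
  interpret prob_space \<mu> by (rule gibbs_measureD[OF \<mu>])
  define w where "w = gibbs_weight (\<pi> \<Lambda>) H \<Lambda>"
  define F where "F = (\<lambda>\<gamma>. \<integral>\<gamma>'. w \<gamma> \<gamma>' \<partial>\<pi> \<Lambda>)"
  \<comment> \<open>The value 1 comes from normalisation, the value 0 from a failure of
    integrability or a degenerate partition function. Hence \<open>1 - F \<gamma>\<close> is never
    negative, and a mean of 1 leaves only 1 almost surely.\<close>
  have F: "F \<gamma> = 0 \<or> F \<gamma> = 1" for \<gamma>
  proof (cases "integrable (\<pi> \<Lambda>) (w \<gamma>)")
    case int: True
    let ?Z = "partition_function (\<pi> \<Lambda>) H \<Lambda> \<gamma>"
    let ?b = "\<lambda>\<gamma>'. boltzmann (H \<Lambda> (glue \<Lambda> \<gamma>' \<gamma>))"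
    show ?thesis
    proof (cases "enn2real ?Z = 0")
      case False
      have b: "?b = (\<lambda>\<gamma>'. enn2real ?Z * w \<gamma> \<gamma>')"
        using False by (simp add: w_def gibbs_weight_def fun_eq_iff)
      have "?b \<in> borel_measurable (\<pi> \<Lambda>)"
        unfolding b using borel_measurable_integrable[OF int] by simp
      then have "(\<integral>\<gamma>'. ?b \<gamma>' \<partial>\<pi> \<Lambda>) = enn2real ?Z"
        unfolding partition_function_def by (rule integral_eq_nn_integral) (simp add: boltzmann_nonneg)
      moreover have "(\<integral>\<gamma>'. ?b \<gamma>' \<partial>\<pi> \<Lambda>) = enn2real ?Z * F \<gamma>" unfolding b F_def by simp
      ultimately show ?thesis using False by simp
    qed (simp add: F_def w_def gibbs_weight_def)
  qed (simp add: F_def not_integrable_integral_eq)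
  have "(\<integral>\<gamma>. 1 \<partial>\<mu>) = (\<integral>\<gamma>. F \<gamma> \<partial>\<mu>)"
    using gibbs_dlr[OF \<mu> \<Lambda>, of "\<lambda>_. 1"] by (simp add: F_def w_def image_constant_conv)
  then have F1: "(\<integral>\<gamma>. F \<gamma> \<partial>\<mu>) = 1" by (simp add: prob_space)
  then have int: "integrable \<mu> F" using not_integrable_integral_eq[of \<mu> F] by force
  then have "(\<integral>\<gamma>. 1 - F \<gamma> \<partial>\<mu>) = 0" using F1 by (simp add: prob_space)
  moreover have "integrable \<mu> (\<lambda>\<gamma>. 1 - F \<gamma>)" using int by simp
  moreover have "0 \<le> 1 - F \<gamma>" for \<gamma> using F[of \<gamma>] by auto
  ultimately have "AE \<gamma> in \<mu>. 1 - F \<gamma> = 0" by (subst (asm) integral_nonneg_eq_0_iff_AE) auto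
  then show ?thesis
  proof eventually_elim
    case (elim \<gamma>)
    then have "F \<gamma> = 1" by simp
    moreover from this have "integrable (\<pi> \<Lambda>) (w \<gamma>)"
      using not_integrable_integral_eq[of "\<pi> \<Lambda>" "w \<gamma>"] by (force simp: F_def)
    ultimately show ?case by (simp add: F_def w_def)
  qed
qed

text \<open>The complement of \<open>E\<close> is tested rather than \<open>E\<close>: an outer
  integral 0 might be the default of a non-integrable function, whereas the value 1 certifies
  integrability. The inner integral is then at most 1 with mean 1, yet the configurations in
  \<open>G\<close> keep it strictly below 1.\<close>

lemma gibbs_measure_pos:
  assumes \<mu>: "gibbs_measure \<pi> H \<mu>" and \<Lambda>: "\<Lambda> \<in> bounded_borel" and P: "poisson_process \<nu> (\<pi> \<Lambda>)"
    and E: "E \<in> sets config_space" and G: "G \<in> sets (\<pi> \<Lambda>)" "0 < measure (\<pi> \<Lambda>) G"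
    and glue: "\<And>\<gamma> \<gamma>'. \<gamma> \<in> configs \<Longrightarrow> \<gamma>' \<in> G \<Longrightarrow>
      glue \<Lambda> \<gamma>' \<gamma> \<in> E \<and> H \<Lambda> (glue \<Lambda> \<gamma>' \<gamma>) < \<infinity>"
  shows "0 < measure \<mu> E"
proof (rule ccontr)
  assume "\<not> 0 < measure \<mu> E"
  then have E0: "measure \<mu> E = 0" using measure_nonneg[of \<mu> E] by linarith
  interpret prob_space \<mu> by (rule gibbs_measureD[OF \<mu>])
  interpret P: prob_space "\<pi> \<Lambda>" by (rule poisson_processD[OF P])
  note sp = gibbs_measureD(3)[OF \<mu>]
  define w where "w = gibbs_weight (\<pi> \<Lambda>) H \<Lambda>"
  let ?E' = "configs - E"
  let ?F = "\<lambda>\<gamma>. \<integral>\<gamma>'. indicator ?E' (glue \<Lambda> \<gamma>' \<gamma>) * w \<gamma> \<gamma>' \<partial>\<pi> \<Lambda>"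
  have E': "?E' \<in> sets config_space" using E sets.compl_sets[OF E] by (simp add: space_config_space)
  have "measure \<mu> ?E' = 1"
    using prob_compl[of E] E E0 by (simp add: sp gibbs_measureD(2)[OF \<mu>])
  then have F1: "(\<integral>\<gamma>. ?F \<gamma> \<partial>\<mu>) = 1" using gibbs_dlr_indicator[OF \<mu> \<Lambda> E'] by (simp add: w_def)
  then have int: "integrable \<mu> ?F" using not_integrable_integral_eq[of \<mu> ?F] by force
  have less: "AE \<gamma> in \<mu>. ?F \<gamma> < 1"
    using gibbs_weight_integral_1[OF \<mu> \<Lambda>] AE_space
  proof eventually_elim
    case (elim \<gamma>)
    then have \<gamma>: "\<gamma> \<in> configs" and w: "integrable (\<pi> \<Lambda>) (w \<gamma>)" "(\<integral>\<gamma>'. w \<gamma> \<gamma>' \<partial>\<pi> \<Lambda>) = 1"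
      by (simp_all add: sp w_def)
    have wn: "0 \<le> w \<gamma> \<gamma>'" for \<gamma>' by (simp add: w_def gibbs_weight_nonneg)
    have meas: "(\<lambda>\<gamma>'. indicator A (glue \<Lambda> \<gamma>' \<gamma>) :: real) \<in> borel_measurable (\<pi> \<Lambda>)"
      if "A \<in> sets config_space" for A
      using measurable_compose[OF measurable_glue[OF \<gamma> \<Lambda> poisson_processD(2)[OF P]]
          borel_measurable_indicator[OF that]] .
    have intA: "integrable (\<pi> \<Lambda>) (\<lambda>\<gamma>'. indicator A (glue \<Lambda> \<gamma>' \<gamma>) * w \<gamma> \<gamma>')"
      if "A \<in> sets config_space" for A
      by (rule Bochner_Integration.integrable_bound[OF w(1)])
         (use meas[OF that] borel_measurable_integrable[OF w(1)] wn in \<open>auto simp: indicator_def\<close>)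
    have "?F \<gamma> + (\<integral>\<gamma>'. indicator E (glue \<Lambda> \<gamma>' \<gamma>) * w \<gamma> \<gamma>' \<partial>\<pi> \<Lambda>) = (\<integral>\<gamma>'. w \<gamma> \<gamma>' \<partial>\<pi> \<Lambda>)"
    proof (subst Bochner_Integration.integral_add[symmetric, OF intA[OF E'] intA[OF E]],
        rule Bochner_Integration.integral_cong[OF refl])
      fix \<gamma>' assume "\<gamma>' \<in> space (\<pi> \<Lambda>)"
      then have "glue \<Lambda> \<gamma>' \<gamma> \<in> configs"
        using glue_in_configs[OF \<gamma> _ bounded_borelD(1)[OF \<Lambda>]] poisson_processD(3)[OF P] by simp
      then show "indicator ?E' (glue \<Lambda> \<gamma>' \<gamma>) * w \<gamma> \<gamma>' + indicator E (glue \<Lambda> \<gamma>' \<gamma>) * w \<gamma> \<gamma>' = w \<gamma> \<gamma>'"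
        by (simp add: indicator_def)
    qed
    \<comment> \<open>On \<open>G\<close> the indicator is 1 and the weight is positive, so a
      vanishing integral would make \<open>G\<close> a null set.\<close>
    moreover have "(\<integral>\<gamma>'. indicator E (glue \<Lambda> \<gamma>' \<gamma>) * w \<gamma> \<gamma>' \<partial>\<pi> \<Lambda>) \<noteq> 0"
    proof
      assume "(\<integral>\<gamma>'. indicator E (glue \<Lambda> \<gamma>' \<gamma>) * w \<gamma> \<gamma>' \<partial>\<pi> \<Lambda>) = 0"
      then have "AE \<gamma>' in \<pi> \<Lambda>. indicator E (glue \<Lambda> \<gamma>' \<gamma>) * w \<gamma> \<gamma>' = 0"
        by (subst (asm) integral_nonneg_eq_0_iff_AE[OF intA[OF E]]) (use wn in auto)
      then have "AE \<gamma>' in \<pi> \<Lambda>. \<gamma>' \<notin> G"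
      proof eventually_elim
        case (elim \<gamma>')
        \<comment> \<open>Division by zero would make the weight vanish, but its integral is
          1.\<close>
        have "enn2real (partition_function (\<pi> \<Lambda>) H \<Lambda> \<gamma>) \<noteq> 0"
          using w(2) by (auto simp: w_def gibbs_weight_def)
        then show ?case using elim glue[OF \<gamma>, of \<gamma>']
          by (auto simp: w_def gibbs_weight_def boltzmann_def)
      qed
      then have "G \<in> null_sets (\<pi> \<Lambda>)" using G(1) by (simp add: AE_iff_null_sets)
      then show False using G(2) by (simp add: measure_def null_sets_def)
    qed
    moreover have "0 \<le> (\<integral>\<gamma>'. indicator E (glue \<Lambda> \<gamma>' \<gamma>) * w \<gamma> \<gamma>' \<partial>\<pi> \<Lambda>)"
      using wn by (intro integral_nonneg_AE) auto
    ultimately show ?case using w(2) by linarith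
  qed
  have "(\<integral>\<gamma>. 1 - ?F \<gamma> \<partial>\<mu>) = 0" using F1 int by (simp add: prob_space)
  moreover have "AE \<gamma> in \<mu>. 0 \<le> 1 - ?F \<gamma>" using less by eventually_elim simp
  ultimately have "AE \<gamma> in \<mu>. 1 - ?F \<gamma> = 0"
    using int by (subst (asm) integral_nonneg_eq_0_iff_AE) auto
  then have "AE \<gamma> in \<mu>. False" using less by eventually_elim simp
  then show False by simp
qed

section \<open>The Poisson process\<close>

text \<open>Independence gives a product of Poisson weights, and such a weight is 0 only for a
  positive count at rate zero.\<close>

lemma poisson_counts_pos:
  fixes A :: "nat \<Rightarrow> 'v::euclidean_space set" and n :: "nat \<Rightarrow> nat"
  assumes P: "poisson_process \<nu> P" and A: "range A \<subseteq> bounded_borel" "disjoint_family A"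
    and J: "finite J" "J \<noteq> {}" and pos: "\<And>j. j \<in> J \<Longrightarrow> 0 < measure \<nu> (A j) \<or> n j = 0"
  defines "G \<equiv> \<Inter>j\<in>J. {\<gamma> \<in> space P. emeasure \<gamma> (A j) = of_nat (n j)}"
  shows "G \<in> sets P" "0 < measure P G"
proof -
  interpret prob_space P by (rule poisson_processD[OF P])
  have ind: "indep_vars (\<lambda>_. borel) (\<lambda>i \<gamma>. emeasure \<gamma> (A i)) UNIV"
    using P A by (simp add: poisson_process_def)
  have eq: "{\<gamma> \<in> space P. emeasure \<gamma> (A j) = of_nat (n j)} = (\<lambda>\<gamma>. emeasure \<gamma> (A j)) -` {of_nat (n j)} \<inter> space P" for j
    by auto
  have "(\<lambda>\<gamma>. emeasure \<gamma> (A j)) \<in> borel_measurable P" for j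
    using ind by (simp add: indep_vars_def)
  then have "{\<gamma> \<in> space P. emeasure \<gamma> (A j) = of_nat (n j)} \<in> sets P" for j
    unfolding eq by (rule measurable_sets) simp
  then show "G \<in> sets P" unfolding G_def using J by (intro sets.finite_INT) auto
  have "measure P G = (\<Prod>j\<in>J. measure P {\<gamma> \<in> space P. emeasure \<gamma> (A j) = of_nat (n j)})"
    unfolding G_def eq by (rule indep_varsD[OF ind J(2,1)]) auto
  also have "\<dots> = (\<Prod>j\<in>J. measure \<nu> (A j) ^ n j / fact (n j) * exp (- measure \<nu> (A j)))"
    using P A(1) by (auto simp: poisson_process_def intro!: prod.cong)
  also have "0 < \<dots>"
    using pos by (intro prod_pos) (force intro!: mult_pos_pos divide_pos_pos)
  finally show "0 < measure P G" .
qed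

lemma poisson_one_point_per_ball:
  fixes z :: "nat \<Rightarrow> 'v::euclidean_space"
  assumes P: "poisson_process (density lborel (indicator \<Lambda>)) P" and \<Lambda>: "\<Lambda> \<in> bounded_borel"
    and e: "0 < e" and sub: "\<And>j. j < m \<Longrightarrow> ball (z j) e \<subseteq> \<Lambda>"
    and disj: "\<And>i j. i < m \<Longrightarrow> j < m \<Longrightarrow> i \<noteq> j \<Longrightarrow> ball (z i) e \<inter> ball (z j) e = {}"
  obtains G where "G \<in> sets P" "0 < measure P G" "G \<subseteq> configs"
    "\<forall>\<gamma>\<in>G. \<exists>b. (\<forall>j<m. b j \<in> ball (z j) e) \<and> points \<gamma> \<inter> \<Lambda> = b ` {..<m}"
proof -
  \<comment> \<open>Index \<open>m\<close> stands for the remainder of \<Lambda>, which has to stay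
    empty; the empty sets beyond it complete the sequence that the definition of independence asks
    for.\<close>
  define A where "A = (\<lambda>j. if j < m then ball (z j) e else if j = m then \<Lambda> - (\<Union>j<m. ball (z j) e) else {})"
  define n :: "nat \<Rightarrow> nat" where "n = (\<lambda>j. if j < m then 1 else 0)"
  let ?G = "\<Inter>j\<in>{..m}. {\<gamma> \<in> space P. emeasure \<gamma> (A j) = of_nat (n j)}"
  have "\<Lambda> - (\<Union>j<m. ball (z j) e) \<in> bounded_borel"
    by (rule bounded_borel_subset[OF \<Lambda>]) (use bounded_borelD(1)[OF \<Lambda>] in auto)
  then have A: "range A \<subseteq> bounded_borel" by (auto simp: A_def)
  then have Aj: "A j \<in> bounded_borel" for j by auto
  have dA: "disjoint_family A"
    using disj by (auto simp: disjoint_family_on_def A_def)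
  have "0 < measure (density lborel (indicator \<Lambda>)) (A j) \<or> n j = 0" for j
  proof (cases "j < m")
    case True
    have "emeasure (density lborel (indicator \<Lambda>)) (ball (z j) e) = emeasure lborel (ball (z j) e)"
      using sub[OF True] bounded_borelD(1)[OF \<Lambda>]
      by (simp add: emeasure_density indicator_inter_arith[symmetric] Int_absorb1)
    then have "measure (density lborel (indicator \<Lambda>)) (A j) = measure lborel (ball (z j) e)"
      using True by (simp add: A_def measure_def)
    then show ?thesis using content_ball_pos[OF e] by simp
  qed (simp add: n_def)
  note G = poisson_counts_pos[OF P A dA, of "{..m}" n, OF _ _ this]
  show thesis
  proof (rule that[of ?G])
    show "?G \<in> sets P" "0 < measure P ?G" using G by simp_all
    show conf: "?G \<subseteq> configs" using poisson_processD(3)[OF P] by auto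
    show "\<forall>\<gamma>\<in>?G. \<exists>b. (\<forall>j<m. b j \<in> ball (z j) e) \<and> points \<gamma> \<inter> \<Lambda> = b ` {..<m}"
    proof
      fix \<gamma> assume \<gamma>G: "\<gamma> \<in> ?G"
      then have \<gamma>: "\<gamma> \<in> configs" using conf by blast
      have card: "card (points \<gamma> \<inter> A j) = n j" if "j \<le> m" for j
        using \<gamma>G that emeasure_configs_eq_of_nat_iff[OF \<gamma> Aj] by auto
      have "\<exists>b. points \<gamma> \<inter> ball (z j) e = {b}" if "j < m" for j
        using card[of j] that by (auto simp: A_def n_def card_1_singleton_iff)
      then obtain b where b: "\<And>j. j < m \<Longrightarrow> points \<gamma> \<inter> ball (z j) e = {b j}" by metis
      have "points \<gamma> \<inter> A m = {}"
        using card[of m] finite_points[OF \<gamma> bounded_borelD(2)[OF Aj]] by (simp add: n_def)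
      then have "points \<gamma> \<inter> \<Lambda> \<subseteq> (\<Union>j<m. points \<gamma> \<inter> ball (z j) e)" by (auto simp: A_def)
      moreover have "(\<Union>j<m. points \<gamma> \<inter> ball (z j) e) \<subseteq> points \<gamma> \<inter> \<Lambda>" using sub by blast
      moreover have "(\<Union>j<m. points \<gamma> \<inter> ball (z j) e) = b ` {..<m}" using b by auto
      ultimately have "points \<gamma> \<inter> \<Lambda> = b ` {..<m}" by blast
      moreover have "\<forall>j<m. b j \<in> ball (z j) e" using b by blast
      ultimately show "\<exists>b. (\<forall>j<m. b j \<in> ball (z j) e) \<and> points \<gamma> \<inter> \<Lambda> = b ` {..<m}" by blast
    qed
  qed
qed

lemma poisson_AE_no_point_at:
  assumes P: "poisson_process \<nu> P" and "measure \<nu> {x} = 0"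
  shows "AE \<gamma> in P. x \<notin> points \<gamma>"
proof -
  interpret prob_space P by (rule poisson_processD[OF P])
  have "\<forall>A\<in>bounded_borel. \<forall>n. measure P {\<gamma> \<in> space P. emeasure \<gamma> A = of_nat n}
      = measure \<nu> A ^ n / fact n * exp (- measure \<nu> A)"
    using P by (simp add: poisson_process_def)
  \<comment> \<open>Rate 0 and count 0 give the weight \<open>0 ^ 0 / fact 0 * exp 0\<close>, which
    is 1.\<close>
  from this[rule_format, of "{x}" 0] have "measure P {\<gamma> \<in> space P. emeasure \<gamma> {x} = 0} = 1"
    using assms(2) by simp
  moreover have "{\<gamma> \<in> space P. emeasure \<gamma> {x} = 0} \<in> sets P"
    using sets_no_points[of "{x}"] poisson_processD[OF P]
    by (simp add: space_config_space points_def)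
  ultimately have "AE \<gamma> in P. emeasure \<gamma> {x} = 0" by (subst (asm) prob_Collect_eq_1) auto
  then show ?thesis by eventually_elim (simp add: points_def)
qed

section \<open>Small events weighted to remain integrable\<close>

text \<open>With \<open>t\<^sub>k \<rightarrow> 0\<close> such that \<open>B t\<^sub>k\<close> has probability at most \<open>4\<^sup>-\<^sup>k\<close>, take
  \<open>g = 1 + \<Sum>k. 2\<^sup>k 1\<^bsub>B t\<^sub>k\<^esub>\<close>, and \<open>\<delta> t\<close> of order \<open>2\<^sup>-\<^sup>k\<close> for \<open>t\<close> between \<open>t\<^sub>k\<close> and
  its predecessor.\<close>

lemma (in prob_space) integrable_weight_for_vanishing_events:
  fixes B :: "real \<Rightarrow> 'a set"
  assumes B: "\<And>s. B s \<in> events" and mono: "\<And>s t. s \<le> t \<Longrightarrow> B s \<subseteq> B t"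
    and empty: "(\<Inter>n. B (1 / Suc n)) = {}"
  obtains \<delta> :: "real \<Rightarrow> real" and g where "(\<delta> \<longlongrightarrow> 0) (nhds 0)" "\<forall>t. 0 \<le> \<delta> t"
    "integrable M g" "\<forall>\<omega>. 1 \<le> g \<omega>" "\<forall>t>0. \<forall>\<omega>\<in>B t. 1 \<le> g \<omega> * \<delta> t"
proof -
  have "(\<lambda>n. prob (B (1 / Suc n))) \<longlonglongrightarrow> prob (\<Inter>n. B (1 / Suc n))"
  proof (rule finite_Lim_measure_decseq)
    show "range (\<lambda>n. B (1 / Suc n)) \<subseteq> events" using B by blast
    show "decseq (\<lambda>n. B (1 / Suc n))"
      unfolding decseq_def by (intro allI impI mono divide_left_mono) auto
  qed
  then have lim: "(\<lambda>n. prob (B (1 / Suc n))) \<longlonglongrightarrow> 0" by (simp only: empty measure_empty)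
  \<comment> \<open>The probability bound leaves \<open>2^k * (1/4)^k\<close>, which is summable;
    the bound \<open>1 / Suc k\<close> sends the thresholds to 0, so each \<omega> lies in only
    finitely many of the events.\<close>
  have "\<exists>t>0. t \<le> 1 / Suc k \<and> prob (B t) \<le> (1/4)^k" for k
  proof -
    have "\<forall>\<^sub>F n in sequentially. prob (B (1 / Suc n)) < (1/4)^k"
      by (rule order_tendstoD(2)[OF lim]) simp
    then obtain n where n: "\<And>l. n \<le> l \<Longrightarrow> prob (B (1 / Suc l)) < (1/4)^k"
      by (auto simp: eventually_sequentially)
    show ?thesis
    proof (intro exI[of _ "1 / Suc (max n k)"] conjI)
      show "1 / real (Suc (max n k)) \<le> 1 / real (Suc k)" by (intro divide_left_mono) auto
      show "prob (B (1 / Suc (max n k))) \<le> (1/4)^k" by (rule less_imp_le, rule n) simp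
    qed simp
  qed
  then obtain t where t: "\<And>k. 0 < t k" "\<And>k. t k \<le> 1 / Suc k" "\<And>k. prob (B (t k)) \<le> (1/4)^k" by metis
  define f where "f = (\<lambda>k \<omega>. 2 ^ k * indicator (B (t k)) \<omega> :: real)"
  have fnn: "0 \<le> f k \<omega>" for k \<omega> by (simp add: f_def)
  have summ: "summable (\<lambda>k. f k \<omega>)" for \<omega>
  proof -
    obtain n where n: "\<omega> \<notin> B (1 / Suc n)" using empty by blast
    have "f k \<omega> = 0" if "k \<notin> {..<n}" for k
    proof -
      have "t k \<le> 1 / Suc n" using t(2)[of k] that by (intro order_trans[OF t(2)] divide_left_mono) auto
      then have "\<omega> \<notin> B (t k)" using mono n by blast
      then show ?thesis by (simp add: f_def)
    qed
    then show ?thesis by (intro summable_finite[of "{..<n}"]) auto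
  qed
  define g where "g = (\<lambda>\<omega>. 1 + (\<Sum>k. f k \<omega>))"
  \<comment> \<open>If \<open>j\<close> is the least index and positive, then
    \<open>s < t (j - 1)\<close>, so only the weight \<open>2 ^ (j - 1)\<close> is guaranteed on
    \<open>B s\<close>; the factor 2 makes up for the lost index.\<close>
  define \<delta> where "\<delta> = (\<lambda>s. if s \<le> 0 then 0 else 2 * (1/2) ^ (LEAST j. t j \<le> s) :: real)"
  have f_int: "integrable M (f k)" for k
    unfolding f_def using B by (intro integrable_mult_right integrable_real_indicator) (auto simp: less_top[symmetric])
  have "integrable M (\<lambda>\<omega>. \<Sum>k. f k \<omega>)"
  proof (rule integrable_suminf[OF f_int])
    show "AE \<omega> in M. summable (\<lambda>k. norm (f k \<omega>))" using summ fnn by simp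
    have le: "norm (\<integral>\<omega>. norm (f k \<omega>) \<partial>M) \<le> (1/2)^k" for k
    proof -
      have "(\<integral>\<omega>. norm (f k \<omega>) \<partial>M) = 2^k * prob (B (t k))"
        using fnn B by (simp add: f_def)
      also have "\<dots> \<le> 2^k * (1/4)^k" using t(3) by simp
      also have "\<dots> = (1/2)^k" by (simp flip: power_mult_distrib)
      finally show ?thesis by simp
    qed
    show "summable (\<lambda>k. \<integral>\<omega>. norm (f k \<omega>) \<partial>M)"
      by (rule summable_comparison_test'[OF summable_geometric, of "1/2" 0]) (simp, rule le)
  qed
  then have g_int: "integrable M g" by (simp add: g_def)
  have g_ge: "1 + f k \<omega> \<le> g \<omega>" for k \<omega>
    using sum_le_suminf[OF summ, of "{k}" \<omega>] fnn by (simp add: g_def)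
  have g1: "1 \<le> g \<omega>" for \<omega> using g_ge[of 0 \<omega>] fnn[of 0 \<omega>] by linarith
  have \<delta>0: "0 \<le> \<delta> s" for s by (simp add: \<delta>_def)
  have lim0: "(\<delta> \<longlongrightarrow> 0) (nhds 0)"
  proof (rule tendstoI)
    fix e :: real assume "0 < e"
    then obtain m where m: "(1/2)^m < e / 2" using real_arch_pow_inv[of "e/2" "1/2"] by auto
    \<comment> \<open>The thresholds need not be monotone; below the minimum of the first ones the
      least index exceeds \<open>m\<close>.\<close>
    define c where "c = Min (t ` {..m})"
    have c: "0 < c" "\<And>k. k \<le> m \<Longrightarrow> c \<le> t k" using t(1) by (simp_all add: c_def)
    have "\<delta> s < e" if "s < c" for s
    proof (cases "s \<le> 0")
      case False
      obtain n where "1 / real (Suc n) < s" using nat_approx_posE[of s] False by auto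
      then have "t n \<le> s" using t(2)[of n] by linarith
      then have "t (LEAST j. t j \<le> s) \<le> s" by (rule LeastI)
      then have "m \<le> (LEAST j. t j \<le> s)" using c(2) that by (meson leI less_imp_le not_le order_trans)
      then have "(1/2::real) ^ (LEAST j. t j \<le> s) \<le> (1/2)^m" by (intro power_decreasing) auto
      moreover have "\<delta> s = 2 * (1/2) ^ (LEAST j. t j \<le> s)" using False by (simp add: \<delta>_def)
      ultimately show ?thesis using m by linarith
    qed (use \<open>0 < e\<close> in \<open>simp add: \<delta>_def\<close>)
    then show "\<forall>\<^sub>F s in nhds 0. dist (\<delta> s) 0 < e"
      unfolding eventually_nhds_metric using c(1) \<delta>0 by (intro exI[of _ c]) (auto simp: dist_real_def)
  qed
  have "1 \<le> g \<omega> * \<delta> s" if s: "0 < s" "\<omega> \<in> B s" for \<omega> s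
  proof -
    obtain n where "1 / real (Suc n) < s" using nat_approx_posE[OF s(1)] by auto
    then have "t n \<le> s" using t(2)[of n] by linarith
    define j where "j = (LEAST j. t j \<le> s)"
    have \<delta>j: "\<delta> s = 2 * (1/2)^j" using s(1) by (simp add: \<delta>_def j_def)
    show ?thesis
    proof (cases j)
      case 0
      then show ?thesis using g1[of \<omega>] \<delta>j by simp
    next
      case (Suc i)
      then have "\<not> t i \<le> s" using not_less_Least[of i "\<lambda>j. t j \<le> s"] by (simp add: j_def)
      then have "\<omega> \<in> B (t i)" using mono[of s "t i"] s(2) by auto
      then have "2^i \<le> g \<omega>" using g_ge[of i \<omega>] by (simp add: f_def)
      then have "2^i * (2 * (1/2)^j) \<le> g \<omega> * \<delta> s" unfolding \<delta>j by (intro mult_right_mono) auto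
      moreover have "2^i * (2 * (1/2)^j) = (1::real)" by (simp add: Suc power_one_over)
      ultimately show ?thesis by simp
    qed
  qed
  then show thesis using that[OF lim0 _ g_int] \<delta>0 g1 by blast
qed

text \<open>Only finitely many points lie near each sphere, so the positive excesses of their
  distances over the radius have a minimum. Used to show that the events of (H6') shrink to the
  empty set.\<close>

lemma shell_gap:
  assumes \<gamma>: "\<gamma> \<in> configs" and "finite C"
  shows "\<exists>d>0. \<forall>c\<in>C. points \<gamma> \<inter> shell x c (c + d) = {}"
  using \<open>finite C\<close>
proof induction
  case empty
  show ?case by (intro exI[of _ 1]) simp
next
  case (insert c C)
  then obtain d where d: "0 < d" "\<forall>c\<in>C. points \<gamma> \<inter> shell x c (c + d) = {}" by blast
  define D where "D = (\<lambda>y. dist x y - c) ` {y \<in> points \<gamma> \<inter> cball x (c + 1). c < dist x y}"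
  \<comment> \<open>Halved because the outer sphere belongs to the shell; the 1 keeps the candidates
    within \<open>cball x (c + 1)\<close>.\<close>
  define e where "e = Min (insert 1 D) / 2"
  have fin: "finite D"
    unfolding D_def using finite_points[OF \<gamma>, of "cball x (c + 1)"]
    by (intro finite_imageI) (auto elim: rev_finite_subset)
  have "0 < Min (insert 1 D)" using fin by (subst Min_gr_iff) (auto simp: D_def)
  then have e0: "0 < e" by (simp add: e_def)
  have e1: "2 * e \<le> t" if "t \<in> insert 1 D" for t
    using Min_le[OF _ that] fin by (simp add: e_def)
  have e: "points \<gamma> \<inter> shell x c (c + e) = {}"
  proof (rule ccontr)
    assume "points \<gamma> \<inter> shell x c (c + e) \<noteq> {}"
    then obtain y where y: "y \<in> points \<gamma>" "c < dist x y" "dist x y \<le> c + e" by (auto simp: shell_def)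
    then have "dist x y - c \<in> D" using e1[of 1] e0 by (auto simp: D_def)
    then show False using e1[of "dist x y - c"] y(3) e0 by auto
  qed
  have "shell x c' (c' + min d e) \<subseteq> shell x c' (c' + d)" "shell x c' (c' + min d e) \<subseteq> shell x c' (c' + e)" for c'
    by (auto simp: shell_def)
  then have "\<forall>c'\<in>insert c C. points \<gamma> \<inter> shell x c' (c' + min d e) = {}" using d(2) e by blast
  then show ?case using d(1) e0 by (intro exI[of _ "min d e"]) auto
qed

section \<open>The hard sphere model\<close>

locale hard_sphere_model = step_ranges +
  fixes K :: "real set" and \<Theta> :: "(nat \<Rightarrow> real) set"
  assumes K: "compact K" "K \<subseteq> {0<..}" and \<Theta>: "bounded_open_in_Rp p \<Theta>"
begin

lemma K_pos: "\<alpha> \<in> K \<Longrightarrow> 0 < \<alpha>"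
  using K(2) by auto

text \<open>The lower bound limits the range \<open>1/\<alpha> + r p\<close>, the upper bound keeps
  the hard-core diameter \<open>1/\<alpha>\<close> away from 0. Together they make packing constants
  uniform over \<open>K\<close>.\<close>

lemma K_bounds:
  obtains a b where "0 < a" "0 < b" "\<And>\<alpha>. \<alpha> \<in> K \<Longrightarrow> a \<le> \<alpha>" "\<And>\<alpha>. \<alpha> \<in> K \<Longrightarrow> \<alpha> \<le> b"
proof (cases "K = {}")
  case False
  obtain a where "a \<in> K" "\<And>\<alpha>. \<alpha> \<in> K \<Longrightarrow> a \<le> \<alpha>" using compact_attains_inf[OF K(1) False] by blast
  moreover obtain b where "b \<in> K" "\<And>\<alpha>. \<alpha> \<in> K \<Longrightarrow> \<alpha> \<le> b" using compact_attains_sup[OF K(1) False] by blast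
  ultimately show ?thesis using that K_pos by blast
qed (use that[of 1 1] in auto)

lemma abs_le_norm_on: "i \<in> {1..p} \<Longrightarrow> \<bar>\<theta> i\<bar> \<le> norm_on p \<theta>"
  using member_le_L2_set[of "{1..p}" i "\<lambda>i. \<bar>\<theta> i\<bar>"] by (simp add: norm_on_def L2_set_def)

lemma \<Theta>_bound:
  obtains M where "0 \<le> M" "\<And>\<theta> i. \<theta> \<in> \<Theta> \<Longrightarrow> i \<in> {1..p} \<Longrightarrow> \<bar>\<theta> i\<bar> \<le> M"
proof -
  obtain C where C: "\<forall>\<theta>\<in>\<Theta>. norm_on p \<theta> \<le> C" using \<Theta> by (auto simp: bounded_open_in_Rp_def)
  have "\<bar>\<theta> i\<bar> \<le> max 0 C" if "\<theta> \<in> \<Theta>" "i \<in> {1..p}" for \<theta> i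
    using C that(1) abs_le_norm_on[OF that(2), of \<theta>] by force
  then show thesis by (intro that[of "max 0 C"]) auto
qed

text \<open>Elements of \<Theta> are functions fixed outside \<open>{1..p}\<close>, so distinct ones
  differ in a genuine coordinate.\<close>

lemma \<Theta>_neqE:
  assumes "\<theta> \<in> \<Theta>" "\<theta>' \<in> \<Theta>" "\<theta> \<noteq> \<theta>'"
  obtains i where "i \<in> {1..p}" "\<theta> i \<noteq> \<theta>' i"
proof -
  have "\<Theta> \<subseteq> PiE {1..p} (\<lambda>_. UNIV)"
    using \<Theta> openin_subset by (fastforce simp: bounded_open_in_Rp_def)
  then have "\<theta> \<in> extensional {1..p}" "\<theta>' \<in> extensional {1..p}" using assms by (auto simp: PiE_def)
  then show thesis using assms(3) that by (metis extensionalityI)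
qed

lemma abs_weighted_sum_le:
  assumes "\<And>i. i \<in> {1..p} \<Longrightarrow> \<bar>c i\<bar> \<le> M" "\<And>i. i \<in> {1..p} \<Longrightarrow> n i \<le> N" "0 \<le> M"
  shows "\<bar>\<Sum>i=1..p. c i * real (n i)\<bar> \<le> real p * M * real N"
proof -
  have "\<bar>\<Sum>i=1..p. c i * real (n i)\<bar> \<le> (\<Sum>i=1..p. \<bar>c i * real (n i)\<bar>)" by (rule sum_abs)
  also have "\<dots> \<le> (\<Sum>i=1..p. M * real N)"
    using assms by (intro sum_mono) (auto simp: abs_mult intro!: mult_mono)
  finally show ?thesis by simp
qed

lemma shell_subset_cball: "i \<le> p \<Longrightarrow> u + r p \<le> R \<Longrightarrow> shell x a (u + r i) \<subseteq> cball x R"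
  using r_le[of i p] by (auto simp: shell_def)

lemma packing_bound_hard_core:
  assumes "0 < a"
  obtains N where "\<And>c x S (\<gamma> :: 'v::euclidean_space measure). \<gamma> \<in> configs \<Longrightarrow> a \<le> c \<Longrightarrow>
      hard_core c (cball x R) (points \<gamma>) \<Longrightarrow> S \<subseteq> cball x R \<Longrightarrow> card (points \<gamma> \<inter> S) \<le> N"
proof -
  obtain N where N: "\<And>x (P :: 'v set). (\<And>y z. y \<in> P \<inter> cball x R \<Longrightarrow> z \<in> P \<inter> cball x R \<Longrightarrow> y \<noteq> z \<Longrightarrow>
      a / 2 < dist y z) \<Longrightarrow> card (P \<inter> cball x R) \<le> N"
    using packing_bound[of "a/2" R] assms by auto
  show thesis
  proof (rule that[of N])
    fix c x S and \<gamma> :: "'v measure"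
    assume \<gamma>: "\<gamma> \<in> configs" and *: "a \<le> c" "hard_core c (cball x R) (points \<gamma>)" "S \<subseteq> cball x R"
    have "card (points \<gamma> \<inter> cball x R) \<le> N"
      by (rule N) (use *(1,2) assms in \<open>force simp: hard_core_def\<close>)
    moreover have "card (points \<gamma> \<inter> S) \<le> card (points \<gamma> \<inter> cball x R)"
      by (rule card_mono[OF finite_points[OF \<gamma>]]) (use *(3) in auto)
    ultimately show "card (points \<gamma> \<inter> S) \<le> N" by linarith
  qed
qed

text \<open>The bound is uniform in \<open>\<alpha> \<in> K\<close> and \<open>\<theta> \<in> \<Theta>\<close> because the number of points within the range of the
  interaction is bounded by the hard core.\<close>

lemma interaction_at_bound:
  obtains C R where "0 \<le> C"
    "\<And>\<alpha> \<theta> x (\<gamma> :: 'v::euclidean_space measure). \<lbrakk>\<alpha> \<in> K; \<theta> \<in> \<Theta>; \<gamma> \<in> configs;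
       hard_core (1/\<alpha>) (cball x R) (points \<gamma>); interaction_at p r \<alpha> \<theta> x (points \<gamma>) < \<infinity>\<rbrakk>
     \<Longrightarrow> \<bar>interaction_at p r \<alpha> \<theta> x (points \<gamma>)\<bar> \<le> ereal C"
proof -
  obtain a b where ab: "0 < a" "0 < b" "\<And>\<alpha>. \<alpha> \<in> K \<Longrightarrow> a \<le> \<alpha>" "\<And>\<alpha>. \<alpha> \<in> K \<Longrightarrow> \<alpha> \<le> b"
    using K_bounds by blast
  obtain M where M: "0 \<le> M" "\<And>\<theta> i. \<theta> \<in> \<Theta> \<Longrightarrow> i \<in> {1..p} \<Longrightarrow> \<bar>\<theta> i\<bar> \<le> M"
    using \<Theta>_bound by blast
  \<comment> \<open>An upper bound for all interaction ranges over \<open>K\<close>; likewise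
    \<open>1/b\<close> below is a lower bound for all hard-core diameters.\<close>
  define R where "R = 1/a + r p"
  obtain N where N: "\<And>c x S (\<gamma> :: 'v measure). \<gamma> \<in> configs \<Longrightarrow> 1/b \<le> c \<Longrightarrow>
      hard_core c (cball x R) (points \<gamma>) \<Longrightarrow> S \<subseteq> cball x R \<Longrightarrow> card (points \<gamma> \<inter> S) \<le> N"
    using packing_bound_hard_core[of "1/b" R] ab(2) by auto
  show thesis
  proof (rule that[of "real p * M * real N" R])
    show "0 \<le> real p * M * real N" using M by simp
    fix \<alpha> \<theta> x and \<gamma> :: "'v measure"
    assume *: "\<alpha> \<in> K" "\<theta> \<in> \<Theta>" "\<gamma> \<in> configs" "hard_core (1/\<alpha>) (cball x R) (points \<gamma>)"
      and fin: "interaction_at p r \<alpha> \<theta> x (points \<gamma>) < \<infinity>"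
    have \<alpha>: "1/b \<le> 1/\<alpha>" "1/\<alpha> + r p \<le> R"
      using ab *(1) K_pos[OF *(1)] by (auto simp: R_def intro!: divide_left_mono)
    have n: "card (points \<gamma> \<inter> shell x (1/\<alpha> + r (i - 1)) (1/\<alpha> + r i)) \<le> N" if "i \<in> {1..p}" for i
      by (rule N[OF *(3) \<alpha>(1) *(4)], rule shell_subset_cball) (use that \<alpha>(2) in auto)
    have "\<bar>\<Sum>i=1..p. \<theta> i * real (card (points \<gamma> \<inter> shell x (1/\<alpha> + r (i - 1)) (1/\<alpha> + r i)))\<bar> \<le> real p * M * real N"
      by (rule abs_weighted_sum_le[OF M(2)[OF *(2)] n M(1)])
    then show "\<bar>interaction_at p r \<alpha> \<theta> x (points \<gamma>)\<bar> \<le> ereal (real p * M * real N)"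
      using fin by (auto simp: interaction_at_def split: if_splits)
  qed
qed

lemma finite_energy_configs_hard_core:
  assumes "\<gamma> \<in> finite_energy_configs (step_energy p r \<alpha> \<theta>)" "0 < \<alpha>" "\<Lambda> \<in> bounded_borel"
  shows "hard_core (1/\<alpha>) \<Lambda> (points \<gamma>)"
  using assms step_energy_finite_iff[of \<gamma> \<Lambda> \<alpha> \<theta>] bounded_borelD(2)[OF assms(3)]
  by (auto simp: finite_energy_configs_def)

lemma hard_core_mono: "hard_core c \<Lambda> P \<Longrightarrow> c' \<le> c \<Longrightarrow> hard_core c' \<Lambda> P"
  by (force simp: hard_core_def)

subsection \<open>Properties of the energies\<close>

lemma energy_finite_indep_\<theta>:
  assumes "\<gamma> \<in> configs" "\<alpha> \<in> K" "\<Lambda> \<in> bounded_borel"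
  shows "step_energy p r \<alpha> \<theta> \<Lambda> \<gamma> < \<infinity> \<longleftrightarrow> step_energy p r \<alpha> \<theta>' \<Lambda> \<gamma> < \<infinity>"
  using assms by (simp only: step_energy_finite_iff bounded_borelD(2) K_pos)

lemma energy_finite_mono:
  assumes "\<gamma> \<in> configs" "\<alpha> \<in> K" "\<alpha>' \<in> K" "\<Lambda> \<in> bounded_borel" "\<alpha> \<le> \<alpha>'"
    and "step_energy p r \<alpha> \<theta> \<Lambda> \<gamma> < \<infinity>"
  shows "step_energy p r \<alpha>' \<theta> \<Lambda> \<gamma> < \<infinity>"
proof -
  have "1/\<alpha>' \<le> 1/\<alpha>" using assms(2,3,5) K_pos by (intro divide_left_mono) auto
  then show ?thesis
    using assms hard_core_mono by (auto simp only: step_energy_finite_iff bounded_borelD(2) K_pos)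
qed

text \<open>The gap leaves room for a slightly larger diameter \<open>c\<close>, and
  \<open>1/c\<close> is the parameter sought.\<close>

lemma energy_finite_open:
  assumes \<gamma>: "\<gamma> \<in> configs" and \<alpha>': "\<alpha>' \<in> K" and \<Lambda>: "\<Lambda> \<in> bounded_borel"
    and fin: "step_energy p r \<alpha>' \<theta> \<Lambda> \<gamma> < \<infinity>"
  shows "\<exists>\<alpha>. 0 < \<alpha> \<and> \<alpha> < \<alpha>' \<and> step_energy p r \<alpha> \<theta> \<Lambda> \<gamma> < \<infinity>"
proof -
  note \<Lambda>b = bounded_borelD(2)[OF \<Lambda>] and pos = K_pos[OF \<alpha>']
  obtain c where c: "1/\<alpha>' < c" "hard_core c \<Lambda> (points \<gamma>)"
    using hard_core_gap[OF \<gamma> \<Lambda>b] fin step_energy_finite_iff[OF \<gamma> \<Lambda>b pos] by blast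
  have "0 < c" using c(1) pos by (meson less_trans zero_less_divide_1_iff)
  moreover from this have "1/c < \<alpha>'" using c(1) pos by (simp add: field_simps)
  moreover have "step_energy p r (1/c) \<theta> \<Lambda> \<gamma> < \<infinity>"
    using c(2) \<open>0 < c\<close> by (subst step_energy_finite_iff[OF \<gamma> \<Lambda>b]) auto
  ultimately show ?thesis by (intro exI[of _ "1/c"]) auto
qed

subsection \<open>Properties of the local energies\<close>

lemma shell_translate: "shell (x + y) a b = (\<lambda>z. z + y) ` shell x a b"
proof (intro equalityI subsetI)
  fix z assume "z \<in> shell (x + y) a b"
  then have "z - y \<in> shell x a b" by (simp add: shell_def dist_norm algebra_simps)
  then show "z \<in> (\<lambda>z. z + y) ` shell x a b" by (intro image_eqI[of _ _ "z - y"]) auto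
qed (auto simp: shell_def)

lemma interaction_at_translate:
  "interaction_at p r \<alpha> \<theta> (x + y) ((\<lambda>z. z + y) ` P) = interaction_at p r \<alpha> \<theta> x P"
proof -
  have "card ((\<lambda>z. z + y) ` P \<inter> shell (x + y) a b) = card (P \<inter> shell x a b)" for a b
    unfolding shell_translate by (simp flip: image_Int add: card_image)
  moreover have "(\<lambda>z. z + y) ` P \<inter> cball (x + y) a = {} \<longleftrightarrow> P \<inter> cball x a = {}" for a by auto
  ultimately show ?thesis by (simp add: interaction_at_def)
qed

lemma local_energy_translate:
  assumes \<gamma>: "\<gamma> \<in> configs" and \<alpha>: "\<alpha> \<in> K"
    and rem: "x \<in> removable (step_energy p r \<alpha> \<theta>) (add_point \<gamma> x)"
  shows "x + y \<in> removable (step_energy p r \<alpha> \<theta>) (add_point (translate y \<gamma>) (x + y))"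
    and "local_energy (step_energy p r \<alpha> \<theta>) (x + y) (translate y \<gamma>) = local_energy (step_energy p r \<alpha> \<theta>) x \<gamma>"
proof -
  have x: "x \<notin> points \<gamma>" using rem removable_add_point_iff[OF \<gamma> K_pos[OF \<alpha>]] by blast
  then have xy: "x + y \<notin> points (translate y \<gamma>)" by (auto simp: points_translate[OF \<gamma>])
  then show "x + y \<in> removable (step_energy p r \<alpha> \<theta>) (add_point (translate y \<gamma>) (x + y))"
    using removable_add_point_iff[OF translate_in_configs[OF \<gamma>] K_pos[OF \<alpha>]] by blast
  show "local_energy (step_energy p r \<alpha> \<theta>) (x + y) (translate y \<gamma>) = local_energy (step_energy p r \<alpha> \<theta>) x \<gamma>"
    unfolding local_energy_eq_interaction_at[OF \<gamma> K_pos[OF \<alpha>] x]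
      local_energy_eq_interaction_at[OF translate_in_configs[OF \<gamma>] K_pos[OF \<alpha>] xy]
      points_translate[OF \<gamma>] by (rule interaction_at_translate)
qed

lemma local_energy_ge:
  "\<exists>C\<ge>0. \<forall>\<alpha>\<in>K. \<forall>\<theta>\<in>\<Theta>. \<forall>\<gamma>\<in>finite_energy_configs (step_energy p r \<alpha> \<theta>).
     \<forall>x :: 'v::euclidean_space. x \<notin> points \<gamma> \<longrightarrow>
       x \<in> removable (step_energy p r \<alpha> \<theta>) (add_point \<gamma> x) \<and>
       local_energy (step_energy p r \<alpha> \<theta>) x \<gamma> \<ge> ereal (- C)"
proof -
  obtain C R where C: "0 \<le> C" and bd: "\<And>\<alpha> \<theta> x (\<gamma> :: 'v measure). \<lbrakk>\<alpha> \<in> K; \<theta> \<in> \<Theta>; \<gamma> \<in> configs;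
       hard_core (1/\<alpha>) (cball x R) (points \<gamma>); interaction_at p r \<alpha> \<theta> x (points \<gamma>) < \<infinity>\<rbrakk>
     \<Longrightarrow> \<bar>interaction_at p r \<alpha> \<theta> x (points \<gamma>)\<bar> \<le> ereal C"
    using interaction_at_bound by blast
  show ?thesis
  proof (intro exI[of _ C] conjI C ballI allI impI)
    fix \<alpha> \<theta> \<gamma> and x :: 'v
    assume *: "\<alpha> \<in> K" "\<theta> \<in> \<Theta>" "\<gamma> \<in> finite_energy_configs (step_energy p r \<alpha> \<theta>)" and x: "x \<notin> points \<gamma>"
    have \<gamma>: "\<gamma> \<in> configs" using *(3) by (simp add: finite_energy_configs_def)
    note pos = K_pos[OF *(1)]
    show "x \<in> removable (step_energy p r \<alpha> \<theta>) (add_point \<gamma> x)" using removable_add_point_iff[OF \<gamma> pos] x by blast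
    have "ereal (- C) \<le> interaction_at p r \<alpha> \<theta> x (points \<gamma>)"
      using bd[OF *(1,2) \<gamma> finite_energy_configs_hard_core[OF *(3) pos], of x]
      by (cases "interaction_at p r \<alpha> \<theta> x (points \<gamma>)") auto
    then show "ereal (- C) \<le> local_energy (step_energy p r \<alpha> \<theta>) x \<gamma>"
      using local_energy_eq_interaction_at[OF \<gamma> pos x] by simp
  qed
qed

end

subsection \<open>Properties under a Gibbs measure\<close>

text \<open>Kept apart from the model so that it can be instantiated with any Gibbs measure: (S3)
  asks for one radius that serves all of them.\<close>

locale hard_sphere_gibbs = hard_sphere_model +
  fixes \<pi> :: "'v::euclidean_space set \<Rightarrow> 'v measure measure"
    and \<alpha>star :: real and \<theta>star :: "nat \<Rightarrow> real" and \<mu> :: "'v measure measure"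
  assumes poisson: "\<And>\<Lambda>. \<Lambda> \<in> bounded_borel \<Longrightarrow> poisson_process (density lborel (indicator \<Lambda>)) (\<pi> \<Lambda>)"
    and \<alpha>star: "\<alpha>star \<in> K" and \<theta>star: "\<theta>star \<in> \<Theta>"
    and gibbs: "gibbs_measure \<pi> (step_energy p r \<alpha>star \<theta>star) \<mu>"
begin

lemma \<alpha>star_pos: "0 < \<alpha>star"
  by (rule K_pos[OF \<alpha>star])

text \<open>A violation means infinite energy in the same \<Lambda>, hence weight 0 in the DLR
  equation there, for every boundary condition.\<close>

lemma AE_hard_core:
  assumes \<Lambda>: "\<Lambda> \<in> bounded_borel"
  shows "AE \<gamma> in \<mu>. hard_core (1/\<alpha>star) \<Lambda> (points \<gamma>)"
proof -
  let ?E = "{\<gamma> \<in> space config_space. \<not> hard_core (1/\<alpha>star) \<Lambda> (points \<gamma>)}"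
  have "AE \<gamma> in \<mu>. \<gamma> \<notin> ?E"
  proof (rule gibbs_AE_not_in[OF gibbs \<Lambda>])
    show "?E \<in> sets config_space" by (rule sets.sets_Collect_neg[OF sets_hard_core[OF \<Lambda>]])
    show "AE \<gamma>' in \<pi> \<Lambda>. glue \<Lambda> \<gamma>' \<gamma> \<in> ?E \<longrightarrow> step_energy p r \<alpha>star \<theta>star \<Lambda> (glue \<Lambda> \<gamma>' \<gamma>) = \<infinity>" for \<gamma>
    proof (intro AE_I2 impI)
      fix \<gamma>' assume E: "glue \<Lambda> \<gamma>' \<gamma> \<in> ?E"
      then have "\<not> step_energy p r \<alpha>star \<theta>star \<Lambda> (glue \<Lambda> \<gamma>' \<gamma>) < \<infinity>"
        using step_energy_finite_iff[OF _ bounded_borelD(2)[OF \<Lambda>] \<alpha>star_pos] by (simp add: space_config_space)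
      then show "step_energy p r \<alpha>star \<theta>star \<Lambda> (glue \<Lambda> \<gamma>' \<gamma>) = \<infinity>" by simp
    qed
  qed
  then show ?thesis
    using AE_space by eventually_elim (simp add: space_config_space gibbs_measureD(3)[OF gibbs])
qed

text \<open>The DLR equation is applied to \<open>{x}\<close>, a Lebesgue null set: the Poisson
  process on it is almost surely empty, and gluing discards what \<gamma> had there. Thus the closed
  form of the local energy holds almost surely.\<close>

lemma AE_no_point_at: "AE \<gamma> in \<mu>. x \<notin> points \<gamma>"
proof -
  let ?E = "{\<gamma> \<in> space config_space. points \<gamma> \<inter> {x} \<noteq> {}}"
  have "AE \<gamma> in \<mu>. \<gamma> \<notin> ?E"
  proof (rule gibbs_AE_not_in[OF gibbs bounded_borel_basic(1)])
    show "?E \<in> sets config_space" by (rule sets_some_point) simp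
    fix \<gamma> :: "'v measure" assume \<gamma>: "\<gamma> \<in> configs"
    have "emeasure (density lborel (indicator {x})) {x} = 0"
      by (simp add: emeasure_density indicator_inter_arith[symmetric])
    then have "measure (density lborel (indicator {x})) {x} = 0" by (simp add: measure_def)
    from poisson_AE_no_point_at[OF poisson[OF bounded_borel_basic(1)] this]
    show "AE \<gamma>' in \<pi> {x}. glue {x} \<gamma>' \<gamma> \<in> ?E \<longrightarrow> step_energy p r \<alpha>star \<theta>star {x} (glue {x} \<gamma>' \<gamma>) = \<infinity>"
      using AE_space
      by eventually_elim (simp add: points_glue[OF \<gamma>] poisson_processD(3)[OF poisson[OF bounded_borel_basic(1)]])
  qed
  then show ?thesis
    using AE_space by eventually_elim (simp add: space_config_space gibbs_measureD(3)[OF gibbs])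
qed

text \<open>After gluing, nothing is known about the points outside the large ball, so
  \<open>good\<close> must hold for all possible outside points.\<close>

lemma measure_pos_if_one_point_per_ball:
  fixes z :: "nat \<Rightarrow> 'v"
  assumes E: "E \<in> sets config_space" and e: "0 < e"
    and sub: "\<And>j. j < m \<Longrightarrow> ball (z j) e \<subseteq> ball 0 R"
    and disj: "\<And>i j. i < m \<Longrightarrow> j < m \<Longrightarrow> i \<noteq> j \<Longrightarrow> ball (z i) e \<inter> ball (z j) e = {}"
    and good: "\<And>\<gamma> b. \<lbrakk>\<gamma> \<in> configs; \<forall>j<m. b j \<in> ball (z j) e; points \<gamma> \<inter> ball 0 R = b ` {..<m}\<rbrakk> \<Longrightarrow>
       \<gamma> \<in> E \<and> hard_core (1/\<alpha>star) (ball 0 R) (points \<gamma>)"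
  shows "0 < measure \<mu> E"
proof -
  let ?\<Lambda> = "ball (0::'v) R"
  have \<Lambda>: "?\<Lambda> \<in> bounded_borel" by simp
  obtain G where G: "G \<in> sets (\<pi> ?\<Lambda>)" "0 < measure (\<pi> ?\<Lambda>) G" "G \<subseteq> configs"
    "\<forall>\<gamma>\<in>G. \<exists>b. (\<forall>j<m. b j \<in> ball (z j) e) \<and> points \<gamma> \<inter> ?\<Lambda> = b ` {..<m}"
    by (rule poisson_one_point_per_ball[OF poisson[OF \<Lambda>] \<Lambda> e sub disj])
  show ?thesis
  proof (rule gibbs_measure_pos[OF gibbs \<Lambda> poisson[OF \<Lambda>] E G(1,2)])
    fix \<gamma> \<gamma>' :: "'v measure" assume *: "\<gamma> \<in> configs" "\<gamma>' \<in> G"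
    then have \<gamma>': "\<gamma>' \<in> configs" using G(3) by blast
    have L: "?\<Lambda> \<in> sets borel" by simp
    obtain b where b: "\<forall>j<m. b j \<in> ball (z j) e" "points \<gamma>' \<inter> ?\<Lambda> = b ` {..<m}" using G(4) *(2) by blast
    have gl: "glue ?\<Lambda> \<gamma>' \<gamma> \<in> configs" by (rule glue_in_configs[OF *(1) \<gamma>' L])
    have "points (glue ?\<Lambda> \<gamma>' \<gamma>) \<inter> ?\<Lambda> = b ` {..<m}" using points_glue[OF *(1) \<gamma>' L] b(2) by blast
    from good[OF gl b(1) this]
    show "glue ?\<Lambda> \<gamma>' \<gamma> \<in> E \<and> step_energy p r \<alpha>star \<theta>star ?\<Lambda> (glue ?\<Lambda> \<gamma>' \<gamma>) < \<infinity>"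
      using step_energy_finite_iff[OF gl bounded_ball \<alpha>star_pos] by blast
  qed
qed

lemma dist_outside_ball: "R - norm x \<le> dist x y" if "y \<notin> ball 0 R" for x y :: 'v
proof -
  have "norm y - norm x \<le> dist x y"
    using norm_triangle_ineq2[of y x] by (simp add: dist_norm norm_minus_commute)
  then show ?thesis using that by simp
qed

text \<open>Two points at a distance strictly between \<open>1/\<alpha>star\<close> and
  \<open>1/\<alpha>\<close> violate the core for \<alpha> but respect the one for
  \<open>\<alpha>star\<close>. Both have norm below \<open>1/\<alpha>\<close>, so with radius
  \<open>3/\<alpha>\<close> every outside point is farther from them than
  \<open>1/\<alpha>star\<close>.\<close>

lemma energy_infinite_pos:
  assumes \<alpha>: "\<alpha> \<in> K" "\<alpha> < \<alpha>star"
  shows "0 < measure \<mu> {\<gamma> \<in> space \<mu>. step_energy p r \<alpha> \<theta>star (ball 0 (3/\<alpha>)) \<gamma> = \<infinity>}"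
proof -
  note pos = K_pos[OF \<alpha>(1)]
  define R where "R = 3/\<alpha>"
  define c c' where "c = 1/\<alpha>star" and "c' = 1/\<alpha>"
  \<comment> \<open>Moving both points by less than \<open>e\<close> changes their distance by less
    than a quarter of \<open>c' - c\<close>, while \<open>u\<close> starts at half of it from either
    end.\<close>
  define e where "e = (c' - c) / 8"
  have cc: "0 < c" "c < c'" "R = 3 * c'"
    using pos \<alpha>(2) \<alpha>star_pos by (simp_all add: c_def c'_def R_def divide_strict_left_mono)
  have "0 \<le> (c + c') / 2" using cc by simp
  then obtain u :: 'v where u: "norm u = (c + c') / 2" using vector_choose_size by blast
  define z where "z = (\<lambda>j::nat. if j = 0 then 0 else u)"
  let ?E = "{\<gamma> \<in> space config_space. \<not> hard_core c' (ball 0 R) (points \<gamma>)}"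
  have between: "c < dist x y \<and> dist x y < c'" if "x \<in> ball 0 e" "y \<in> ball u e" for x y
  proof -
    have "norm x < e" "dist u y < e" using that by auto
    moreover have "dist x y \<le> norm x + norm u + dist u y"
      using quadrilateral_ineq[of x y 0 u] by simp
    moreover have "norm u \<le> norm x + dist x y + dist u y"
      using quadrilateral_ineq[of 0 u x y] by (simp add: dist_commute)
    ultimately show ?thesis using u cc(1,2) by (auto simp: e_def field_simps)
  qed
  have small: "norm x < c'" if "x \<in> ball (z j) e" for x j
  proof -
    have "norm x \<le> norm (z j) + dist (z j) x" using norm_triangle_sub[of x "z j"] by (simp add: dist_norm norm_minus_commute)
    moreover have "norm (z j) \<le> (c + c') / 2" using u cc by (auto simp: z_def)
    moreover have "dist (z j) x < e" using that by simp
    ultimately show ?thesis using cc(2) by (simp add: e_def field_simps)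
  qed
  have "0 < measure \<mu> ?E"
  proof (rule measure_pos_if_one_point_per_ball[of _ e 2 z R])
    show "?E \<in> sets config_space" by (intro sets.sets_Collect_neg sets_hard_core) simp
    show "0 < e" using cc by (simp add: e_def)
    show "ball (z j) e \<subseteq> ball 0 R" for j using small[of _ j] cc by force
    show "ball (z i) e \<inter> ball (z j) e = {}" if "i < 2" "j < 2" "i \<noteq> j" for i j
    proof -
      have "ball 0 e \<inter> ball u e = {}" using between cc(1) by force
      then show ?thesis using that by (auto simp: z_def)
    qed
    fix \<gamma> and b :: "nat \<Rightarrow> 'v"
    assume \<gamma>: "\<gamma> \<in> configs" and b: "\<forall>j<2. b j \<in> ball (z j) e" "points \<gamma> \<inter> ball 0 R = b ` {..<2}"
    have b01: "b 0 \<in> ball 0 e" "b 1 \<in> ball u e" using b(1)[rule_format, of 0] b(1)[rule_format, of 1] by (auto simp: z_def)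
    have pts: "points \<gamma> \<inter> ball 0 R = {b 0, b 1}" unfolding b(2) by (auto simp: numeral_2_eq_2 lessThan_Suc)
    note d = between[OF b01]
    have "b 0 \<noteq> b 1" using d cc(1) by auto
    then have "\<not> hard_core c' (ball 0 R) (points \<gamma>)"
      using pts d unfolding hard_core_def by (metis Int_iff insertCI not_less_iff_gr_or_eq)
    moreover have "hard_core c (ball 0 R) (points \<gamma>)"
      unfolding hard_core_def
    proof (intro ballI impI)
      fix x y assume xy: "x \<in> points \<gamma> \<inter> ball 0 R" "y \<in> points \<gamma>" "x \<noteq> y"
      show "c < dist x y"
      proof (cases "y \<in> ball 0 R")
        case True
        then have "x \<in> {b 0, b 1}" "y \<in> {b 0, b 1}" using xy unfolding pts[symmetric] by auto
        then show ?thesis using d xy(3) by (auto simp: dist_commute)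
      next
        case False
        have "norm x < c'" using xy(1) pts small[of "b 0" 0] small[of "b 1" 1] b01 by (auto simp: z_def)
        then show ?thesis using dist_outside_ball[OF False, of x] cc by linarith
      qed
    qed
    ultimately show "\<gamma> \<in> ?E \<and> hard_core (1/\<alpha>star) (ball 0 R) (points \<gamma>)"
      using \<gamma> by (simp add: space_config_space c_def)
  qed
  also have "?E = {\<gamma> \<in> space \<mu>. step_energy p r \<alpha> \<theta>star (ball 0 (3/\<alpha>)) \<gamma> = \<infinity>}"
    using step_energy_finite_iff[OF _ bounded_ball pos, of _ \<theta>star 0 R]
    by (auto simp: space_config_space gibbs_measureD(3)[OF gibbs] c'_def R_def)
  finally show ?thesis .
qed

text \<open>An occupied core makes the product infinity times 0, which is 0. Otherwise both local
  energies are at most \<open>C\<close> in modulus, and the product is at most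
  \<open>C * exp C\<close>.\<close>

lemma L1_local_energy_boltzmann:
  assumes \<theta>: "\<theta> \<in> \<Theta>"
  shows "L1_ereal \<mu> (\<lambda>\<gamma>. local_energy (step_energy p r \<alpha>star \<theta>) 0 \<gamma> *
    ereal (boltzmann (local_energy (step_energy p r \<alpha>star \<theta>star) 0 \<gamma>)))"
proof -
  interpret prob_space \<mu> by (rule gibbs_measureD[OF gibbs])
  let ?h = "\<lambda>\<theta>. local_energy (step_energy p r \<alpha>star \<theta>) 0"
  obtain C R where C: "0 \<le> C" and bd: "\<And>\<alpha> \<theta> x (\<gamma> :: 'v measure). \<lbrakk>\<alpha> \<in> K; \<theta> \<in> \<Theta>; \<gamma> \<in> configs;
       hard_core (1/\<alpha>) (cball x R) (points \<gamma>); interaction_at p r \<alpha> \<theta> x (points \<gamma>) < \<infinity>\<rbrakk>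
     \<Longrightarrow> \<bar>interaction_at p r \<alpha> \<theta> x (points \<gamma>)\<bar> \<le> ereal C"
    using interaction_at_bound by blast
  have [measurable]: "?h \<theta> \<in> borel_measurable \<mu>" for \<theta>
    using measurable_local_energy[OF \<alpha>star_pos, of \<theta> 0] measurable_cong_sets[OF gibbs_measureD(2)[OF gibbs] refl] by blast
  have [measurable]: "boltzmann \<in> borel_measurable borel"
    unfolding boltzmann_def by measurable
  have "AE \<gamma> in \<mu>. e2ennreal \<bar>?h \<theta> \<gamma> * ereal (boltzmann (?h \<theta>star \<gamma>))\<bar> \<le> ennreal (C * exp C)"
    using AE_hard_core[OF bounded_borel_basic(3), of 0 R] AE_no_point_at[of 0] AE_space
  proof (eventually_elim)
    case (elim \<gamma>)
    then have \<gamma>: "\<gamma> \<in> configs" by (simp add: gibbs_measureD(3)[OF gibbs])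
    have h: "?h \<theta> \<gamma> = interaction_at p r \<alpha>star \<theta> 0 (points \<gamma>)" for \<theta>
      using local_energy_eq_interaction_at[OF \<gamma> \<alpha>star_pos elim(2)] .
    show ?case
    proof (cases "points \<gamma> \<inter> cball 0 (1/\<alpha>star) = {}")
      case True
      then have fin: "?h \<theta> \<gamma> < \<infinity>" for \<theta> by (simp add: h interaction_at_def)
      obtain s s' where s: "?h \<theta> \<gamma> = ereal s" "?h \<theta>star \<gamma> = ereal s'"
        using True by (simp add: h interaction_at_def)
      have "\<bar>s\<bar> \<le> C" "\<bar>s'\<bar> \<le> C"
        using bd[OF \<alpha>star \<theta> \<gamma>, of 0] bd[OF \<alpha>star \<theta>star \<gamma>, of 0] elim(1) fin[of \<theta>] fin[of \<theta>star] s
        by (simp_all add: h)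
      then have "\<bar>s * exp (- s')\<bar> \<le> C * exp C"
        using C by (simp add: abs_mult) (intro mult_mono, auto)
      then show ?thesis by (simp add: s boltzmann_def ennreal_leI flip: ennreal.abs_eq)
    next
      case False
      then show ?thesis by (simp add: h interaction_at_def boltzmann_def flip: zero_ereal_def)
    qed
  qed
  then have "(\<integral>\<^sup>+\<gamma>. e2ennreal \<bar>?h \<theta> \<gamma> * ereal (boltzmann (?h \<theta>star \<gamma>))\<bar> \<partial>\<mu>) \<le> (\<integral>\<^sup>+\<gamma>. ennreal (C * exp C) \<partial>\<mu>)"
    by (rule nn_integral_mono_AE)
  also have "\<dots> < \<infinity>" by (simp add: emeasure_space_1)
  finally show ?thesis unfolding L1_ereal_def by simp
qed

text \<open>A single point in the shell of a coordinate \<open>i\<close> where the parameters differ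
  makes the two local energies equal to \<open>\<theta>star i\<close> and
  \<open>\<theta> i\<close>.\<close>

lemma local_energies_differ_pos:
  assumes \<theta>: "\<theta> \<in> \<Theta>" "\<theta> \<noteq> \<theta>star"
  shows "0 < measure \<mu> {\<gamma> \<in> space \<mu>. local_energy (step_energy p r \<alpha>star \<theta>star) 0 \<gamma> \<noteq>
    local_energy (step_energy p r \<alpha>star \<theta>) 0 \<gamma>}"
proof -
  obtain i where i: "i \<in> {1..p}" "\<theta>star i \<noteq> \<theta> i" using \<Theta>_neqE[OF \<theta>(1) \<theta>star \<theta>(2)] by metis
  let ?h = "\<lambda>\<theta>. local_energy (step_energy p r \<alpha>star \<theta>) 0"
  let ?E = "{\<gamma> \<in> space config_space. ?h \<theta>star \<gamma> \<noteq> ?h \<theta> \<gamma>}"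
  define c where "c = 1/\<alpha>star"
  \<comment> \<open>The interaction range at the origin is \<open>c + r p\<close>; another
    \<open>c\<close> keeps outside points from entering the core of the single point.\<close>
  define R where "R = 2 * c + r p + 1"
  \<comment> \<open>Less than half the width of the shell in whose middle \<open>u\<close>
    lies.\<close>
  define e where "e = (r i - r (i - 1)) / 4"
  have c: "0 < c" using \<alpha>star_pos by (simp add: c_def)
  have ri: "r (i - 1) < r i" "0 \<le> r (i - 1)" "r i \<le> r p"
    using r_less[of i] r_nonneg[of "i - 1"] r_le[of i p] i(1) by auto
  have "0 \<le> c + (r (i - 1) + r i) / 2" using c ri by simp
  then obtain u :: 'v where u: "norm u = c + (r (i - 1) + r i) / 2" using vector_choose_size by blast
  have sub: "c + r (i - 1) < norm x \<and> norm x < c + r i" if "x \<in> ball u e" for x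
  proof -
    have "norm x \<le> norm u + dist u x" "norm u \<le> norm x + dist u x"
      using norm_triangle_sub[of x u] norm_triangle_sub[of u x] by (simp_all add: dist_norm norm_minus_commute)
    moreover have "dist u x < e" using that by simp
    ultimately show ?thesis using u ri(1) by (auto simp: e_def field_simps)
  qed
  have "0 < measure \<mu> ?E"
  proof (rule measure_pos_if_one_point_per_ball[of _ e 1 "\<lambda>_. u" R])
    show "?E \<in> sets config_space"
      using measurable_local_energy[OF \<alpha>star_pos, of \<theta> 0] measurable_local_energy[OF \<alpha>star_pos, of \<theta>star 0]
      by measurable
    show "0 < e" using ri by (simp add: e_def)
    show "ball u e \<subseteq> ball 0 R" using sub ri c by (force simp: R_def)
    fix \<gamma> and b :: "nat \<Rightarrow> 'v"
    assume \<gamma>: "\<gamma> \<in> configs" and b: "\<forall>j<1. b j \<in> ball u e" "points \<gamma> \<inter> ball 0 R = b ` {..<1}"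
    have b0: "c + r (i - 1) < norm (b 0)" "norm (b 0) < c + r i" using sub b(1) by auto
    have pts: "points \<gamma> \<inter> ball 0 R = {b 0}" using b(2) by (simp add: lessThan_Suc)
    have only: "points \<gamma> \<inter> S = S \<inter> {b 0}" if "S \<subseteq> ball 0 R" for S using pts that by blast
    have "cball 0 c \<subseteq> ball (0::'v) R" "b 0 \<notin> cball 0 c" using c ri b0 by (auto simp: R_def)
    then have core: "points \<gamma> \<inter> cball 0 c = {}" using only[of "cball 0 c"] by auto
    moreover have "0 \<in> cball (0::'v) c" using c by simp
    ultimately have no0: "0 \<notin> points \<gamma>" by blast
    have "card (points \<gamma> \<inter> shell 0 (c + r (j - 1)) (c + r j)) = (if j = i then 1 else 0)" if j: "j \<in> {1..p}" for j
    proof -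
      have "shell 0 (c + r (j - 1)) (c + r j) \<subseteq> ball (0::'v) R"
        using r_le[of j p] j c by (auto simp: shell_def R_def)
      moreover have "b 0 \<in> shell 0 (c + r (j - 1)) (c + r j) \<longleftrightarrow> j = i"
      proof (cases j i rule: linorder_cases)
        case less
        then have "r j \<le> r (i - 1)" using i(1) by (intro r_le) auto
        then show ?thesis using b0 less by (simp add: shell_def)
      next
        case greater
        then have "r i \<le> r (j - 1)" using j by (intro r_le) auto
        then show ?thesis using b0 greater by (simp add: shell_def)
      next
        case equal
        then show ?thesis using b0 by (simp add: shell_def)
      qed
      ultimately show ?thesis using only[of "shell 0 (c + r (j - 1)) (c + r j)"] by (auto simp: Int_insert_right)
    qed
    then have h: "?h \<theta> \<gamma> = ereal (\<theta> i)" for \<theta>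
      using core i(1) unfolding local_energy_eq_interaction_at[OF \<gamma> \<alpha>star_pos no0] interaction_at_def c_def[symmetric]
      by (simp add: if_distrib[of real] if_distrib[of "\<lambda>x. _ * x"] cong: if_cong)
    have "hard_core c (ball 0 R) (points \<gamma>)"
      unfolding hard_core_def
    proof (intro ballI impI)
      fix x y assume xy: "x \<in> points \<gamma> \<inter> ball 0 R" "y \<in> points \<gamma>" "x \<noteq> y"
      then have "x = b 0" "y \<notin> ball 0 R" using pts by (blast, metis Int_iff singletonD)
      then show "c < dist x y" using dist_outside_ball[of y R x] b0 ri c by (simp add: R_def)
    qed
    then show "\<gamma> \<in> ?E \<and> hard_core (1/\<alpha>star) (ball 0 R) (points \<gamma>)"
      using h i(2) \<gamma> by (simp add: space_config_space c_def)
  qed auto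
  then show ?thesis by (simp add: space_config_space gibbs_measureD(3)[OF gibbs])
qed

text \<open>If some point is passed by a moving sphere, the crude packing bound is paid for by
  \<open>1 \<le> g0 \<gamma> * \<delta>0 s\<close>. If not, the shell counts agree and the
  difference is Lipschitz in \<theta>.\<close>

lemma local_energy_continuity:
  "\<exists>(\<delta> :: real \<Rightarrow> real) g. (\<delta> \<longlongrightarrow> 0) (nhds 0) \<and> integrable \<mu> g \<and>
     (\<forall>\<gamma>\<in>finite_energy_configs (step_energy p r \<alpha>star \<theta>star).
        \<forall>\<alpha>\<in>K. \<alpha> \<le> \<alpha>star \<longrightarrow> (\<forall>\<theta>\<in>\<Theta>. \<forall>\<theta>'\<in>\<Theta>.
          0 \<in> removable (step_energy p r \<alpha> \<theta>) (add_point \<gamma> 0) \<and>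
          local_energy (step_energy p r \<alpha> \<theta>) 0 \<gamma> < \<infinity> \<longrightarrow>
          \<bar>local_energy (step_energy p r \<alpha> \<theta>) 0 \<gamma> - local_energy (step_energy p r \<alpha>star \<theta>') 0 \<gamma>\<bar>
            \<le> ereal (g \<gamma> * (\<delta> \<bar>\<alpha> - \<alpha>star\<bar> + \<delta> (norm_on p (\<lambda>i. \<theta> i - \<theta>' i))))))"
proof -
  interpret prob_space \<mu> by (rule gibbs_measureD[OF gibbs])
  note sp = gibbs_measureD(3)[OF gibbs]
  obtain a b where ab: "0 < a" "0 < b" "\<And>\<alpha>. \<alpha> \<in> K \<Longrightarrow> a \<le> \<alpha>" "\<And>\<alpha>. \<alpha> \<in> K \<Longrightarrow> \<alpha> \<le> b"
    using K_bounds by blast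
  obtain M where M: "0 \<le> M" "\<And>\<theta> i. \<theta> \<in> \<Theta> \<Longrightarrow> i \<in> {1..p} \<Longrightarrow> \<bar>\<theta> i\<bar> \<le> M"
    using \<Theta>_bound by blast
  define c where "c = 1/\<alpha>star"
  define R where "R = 1/a + r p"
  have c0: "0 < c" using \<alpha>star_pos by (simp add: c_def)
  obtain N where N: "\<And>c x S (\<gamma> :: 'v measure). \<gamma> \<in> configs \<Longrightarrow> 1/\<alpha>star \<le> c \<Longrightarrow>
      hard_core c (cball x R) (points \<gamma>) \<Longrightarrow> S \<subseteq> cball x R \<Longrightarrow> card (points \<gamma> \<inter> S) \<le> N"
    using packing_bound_hard_core[of "1/\<alpha>star" R] \<alpha>star_pos by auto
  \<comment> \<open>Here \<open>i = 0\<close> is the hard-core sphere, the inner boundary of the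
    first shell. The thickness comes from \<open>1/\<alpha> - 1/\<alpha>star = (\<alpha>star -
    \<alpha>) / (\<alpha> * \<alpha>star)\<close> with both parameters at least
    \<open>a\<close>.\<close>
  define B where "B = (\<lambda>s. {\<gamma> \<in> configs. \<exists>i\<le>p. points \<gamma> \<inter> shell (0::'v) (c + r i) (c + r i + s / a\<^sup>2) \<noteq> {}})"
  have "B s = (\<Union>i\<le>p. {\<gamma> \<in> space config_space. points \<gamma> \<inter> shell 0 (c + r i) (c + r i + s / a\<^sup>2) \<noteq> {}})" for s
    by (auto simp: B_def space_config_space)
  then have B_sets: "B s \<in> events" for s
    by (simp add: gibbs_measureD(2)[OF gibbs] sets.finite_UN sets_some_point)
  have B_mono: "B s \<subseteq> B t" if "s \<le> t" for s t
  proof -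
    have "s / a\<^sup>2 \<le> t / a\<^sup>2" using that by (simp add: divide_right_mono)
    then have "shell (0::'v) (c + r i) (c + r i + s / a\<^sup>2) \<subseteq> shell 0 (c + r i) (c + r i + t / a\<^sup>2)" for i
      by (auto simp: shell_def)
    then show ?thesis unfolding B_def by blast
  qed
  have B_empty: "(\<Inter>n. B (1 / Suc n)) = {}"
  proof (rule equals0I)
    fix \<gamma> assume "\<gamma> \<in> (\<Inter>n. B (1 / Suc n))"
    then have all: "\<gamma> \<in> B (1 / Suc n)" for n by blast
    then have \<gamma>: "\<gamma> \<in> configs" by (simp add: B_def)
    obtain d where d: "0 < d" "\<And>i. i \<le> p \<Longrightarrow> points \<gamma> \<inter> shell 0 (c + r i) (c + r i + d) = {}"
      using shell_gap[OF \<gamma>, of "(\<lambda>i. c + r i) ` {..p}" 0] by auto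
    obtain n where n: "1 / real (Suc n) < d * a\<^sup>2" using nat_approx_posE[of "d * a\<^sup>2"] d(1) ab(1) by auto
    then have "1 / real (Suc n) / a\<^sup>2 < d" using ab(1) by (subst pos_divide_less_eq) auto
    then have "shell (0::'v) (c + r i) (c + r i + 1 / real (Suc n) / a\<^sup>2) \<subseteq> shell 0 (c + r i) (c + r i + d)" for i
      by (auto simp: shell_def)
    then have "\<gamma> \<notin> B (1 / Suc n)" using d(2) unfolding B_def by blast
    then show False using all by blast
  qed
  obtain \<delta>0 and g0 :: "'v measure \<Rightarrow> real" where \<delta>0: "(\<delta>0 \<longlongrightarrow> 0) (nhds 0)" "\<forall>t. 0 \<le> \<delta>0 t"
    and g0: "integrable \<mu> g0" "\<forall>\<omega>. 1 \<le> g0 \<omega>" and \<delta>g: "\<forall>t>0. \<forall>\<omega>\<in>B t. 1 \<le> g0 \<omega> * \<delta>0 t"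
    by (rule integrable_weight_for_vanishing_events[OF B_sets B_mono B_empty])
  \<comment> \<open>The part \<open>2 * M\<close> covers two local energies estimated separately,
    the part 1 the Lipschitz case. In \<delta> the summand \<open>\<bar>t\<bar>\<close> likewise
    serves the dependence on \<theta>.\<close>
  define C where "C = p * real N * (2 * M + 1)"
  define \<delta> where "\<delta> = (\<lambda>t. \<delta>0 t + \<bar>t\<bar>)"
  define g where "g = (\<lambda>\<gamma>. C * g0 \<gamma>)"
  have \<delta>: "(\<delta> \<longlongrightarrow> 0) (nhds 0)"
  proof -
    have "((\<lambda>t::real. \<bar>t\<bar>) \<longlongrightarrow> \<bar>0\<bar>) (nhds 0)" by (intro tendsto_rabs filterlim_ident)
    from tendsto_add[OF \<delta>0(1) this] show ?thesis by (simp add: \<delta>_def)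
  qed
  have C0: "p * real N \<le> C" "p * (2 * M) * real N \<le> C"
    using M(1) by (simp_all add: C_def distrib_left)
  have main: "\<bar>local_energy (step_energy p r \<alpha> \<theta>) 0 \<gamma> - local_energy (step_energy p r \<alpha>star \<theta>') 0 \<gamma>\<bar>
      \<le> ereal (g \<gamma> * (\<delta> \<bar>\<alpha> - \<alpha>star\<bar> + \<delta> (norm_on p (\<lambda>i. \<theta> i - \<theta>' i))))"
    if fe: "\<gamma> \<in> finite_energy_configs (step_energy p r \<alpha>star \<theta>star)" and \<alpha>: "\<alpha> \<in> K" "\<alpha> \<le> \<alpha>star"
      and \<theta>: "\<theta> \<in> \<Theta>" "\<theta>' \<in> \<Theta>" and rem: "0 \<in> removable (step_energy p r \<alpha> \<theta>) (add_point \<gamma> 0)"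
      and fin: "local_energy (step_energy p r \<alpha> \<theta>) 0 \<gamma> < \<infinity>" for \<gamma> \<alpha> \<theta> \<theta>'
  proof -
    have \<gamma>: "\<gamma> \<in> configs" using fe by (simp add: finite_energy_configs_def)
    note pos = K_pos[OF \<alpha>(1)]
    have no0: "0 \<notin> points \<gamma>" using rem removable_add_point_iff[OF \<gamma> pos] by blast
    define u where "u = 1/\<alpha>"
    define s where "s = \<bar>\<alpha> - \<alpha>star\<bar>"
    define \<rho> where "\<rho> = norm_on p (\<lambda>i. \<theta> i - \<theta>' i)"
    have cu: "c \<le> u" unfolding c_def u_def using \<alpha>(2) pos by (intro divide_left_mono) auto
    have us: "u \<le> c + s / a\<^sup>2"
    proof -
      have "u - c = s / (\<alpha> * \<alpha>star)" using pos \<alpha>star_pos \<alpha>(2) by (simp add: u_def c_def s_def field_simps)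
      also have "\<dots> \<le> s / a\<^sup>2"
        using ab(1) ab(3)[OF \<alpha>(1)] ab(3)[OF \<alpha>star] pos \<alpha>star_pos
        by (intro divide_left_mono) (auto simp: s_def power2_eq_square intro!: mult_mono)
      finally show ?thesis by simp
    qed
    have uR: "u + r p \<le> R" "c + r p \<le> R"
      using ab(1) ab(3)[OF \<alpha>(1)] cu pos by (auto simp: u_def R_def intro!: divide_left_mono order_trans[OF cu])
    define n m where "n = (\<lambda>i. card (points \<gamma> \<inter> shell 0 (u + r (i - 1)) (u + r i)))"
      and "m = (\<lambda>i. card (points \<gamma> \<inter> shell 0 (c + r (i - 1)) (c + r i)))"
    have hc: "hard_core (1/\<alpha>star) (cball 0 R) (points \<gamma>)"
      by (rule finite_energy_configs_hard_core[OF fe \<alpha>star_pos]) simp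
    have nN: "n i \<le> N" "m i \<le> N" if "i \<in> {1..p}" for i
      unfolding n_def m_def
      by (rule N[OF \<gamma> order_refl hc], rule shell_subset_cball, use that uR in auto)+
    have "points \<gamma> \<inter> cball 0 u = {}"
      using fin local_energy_eq_interaction_at[OF \<gamma> pos no0] by (auto simp: interaction_at_def u_def split: if_splits)
    \<comment> \<open>The core for \<alpha> contains the one for \<open>\<alpha>star\<close>, so
      finiteness of the first local energy carries over to the second.\<close>
    moreover from this have "points \<gamma> \<inter> cball 0 c = {}" using cu by force
    ultimately have h: "local_energy (step_energy p r \<alpha> \<theta>) 0 \<gamma> = ereal (\<Sum>i=1..p. \<theta> i * real (n i))"
        "local_energy (step_energy p r \<alpha>star \<theta>') 0 \<gamma> = ereal (\<Sum>i=1..p. \<theta>' i * real (m i))"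
      using local_energy_eq_interaction_at[OF \<gamma> pos no0] local_energy_eq_interaction_at[OF \<gamma> \<alpha>star_pos no0]
      by (simp_all add: interaction_at_def n_def m_def u_def c_def)
    have \<rho>0: "0 \<le> \<rho>" by (simp add: \<rho>_def norm_on_def)
    have g0': "0 \<le> g0 \<gamma>" using g0(2)[rule_format, of \<gamma>] by linarith
    have "\<bar>(\<Sum>i=1..p. \<theta> i * real (n i)) - (\<Sum>i=1..p. \<theta>' i * real (m i))\<bar> \<le> C * (g0 \<gamma> * (\<delta>0 s + \<rho>))"
    proof (cases "0 < s \<and> \<gamma> \<in> B s")
      case True
      have "\<bar>\<Sum>i=1..p. \<theta> i * real (n i)\<bar> \<le> p * M * real N"
        by (rule abs_weighted_sum_le[OF M(2)[OF \<theta>(1)] nN(1) M(1)])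
      moreover have "\<bar>\<Sum>i=1..p. \<theta>' i * real (m i)\<bar> \<le> p * M * real N"
        by (rule abs_weighted_sum_le[OF M(2)[OF \<theta>(2)] nN(2) M(1)])
      ultimately have "\<bar>(\<Sum>i=1..p. \<theta> i * real (n i)) - (\<Sum>i=1..p. \<theta>' i * real (m i))\<bar> \<le> p * (2 * M) * real N"
        by (simp add: algebra_simps)
      also have "\<dots> \<le> C * 1" using C0(2) by simp
      also have "\<dots> \<le> C * (g0 \<gamma> * (\<delta>0 s + \<rho>))"
      proof (rule mult_left_mono)
        have "1 \<le> g0 \<gamma> * \<delta>0 s" using \<delta>g True by blast
        also have "\<dots> \<le> g0 \<gamma> * (\<delta>0 s + \<rho>)" using \<rho>0 g0' by (intro mult_left_mono) auto
        finally show "1 \<le> g0 \<gamma> * (\<delta>0 s + \<rho>)" .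
        show "0 \<le> C" using M(1) by (simp add: C_def)
      qed
      finally show ?thesis .
    next
      case False
      \<comment> \<open>A point beyond the old sphere but not beyond the new one would put \<gamma>
        into \<open>B s\<close>; for \<open>s = 0\<close> the spheres coincide.\<close>
      have shift: "c + r j < norm y \<longleftrightarrow> u + r j < norm y" if "y \<in> points \<gamma>" "j \<le> p" for y j
      proof
        assume y: "c + r j < norm y"
        show "u + r j < norm y"
        proof (cases "s = 0")
          case True
          then show ?thesis using us y by simp
        next
          case False
          then have "\<gamma> \<notin> B s" using \<open>\<not> (0 < s \<and> \<gamma> \<in> B s)\<close> by (auto simp: s_def)
          then have "y \<notin> shell 0 (c + r j) (c + r j + s / a\<^sup>2)" using that \<gamma> by (auto simp: B_def)
          then show ?thesis using y us by (simp add: shell_def)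
        qed
      qed (use cu in linarith)
      have "n i = m i" if "i \<in> {1..p}" for i
      proof -
        have "points \<gamma> \<inter> shell 0 (u + r (i - 1)) (u + r i) = points \<gamma> \<inter> shell 0 (c + r (i - 1)) (c + r i)"
          using shift[of _ "i - 1"] shift[of _ i] that by (auto simp: shell_def not_less[symmetric])
        then show ?thesis by (simp add: n_def m_def)
      qed
      then have "(\<Sum>i=1..p. \<theta> i * real (n i)) - (\<Sum>i=1..p. \<theta>' i * real (m i)) = (\<Sum>i=1..p. (\<theta> i - \<theta>' i) * real (n i))"
        by (simp add: left_diff_distrib sum_subtractf)
      also have "\<bar>\<dots>\<bar> \<le> p * \<rho> * real N"
        using abs_weighted_sum_le[OF abs_le_norm_on[of _ "\<lambda>i. \<theta> i - \<theta>' i"] nN(1)] \<rho>0 by (simp add: \<rho>_def)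
      also have "\<dots> = p * real N * (1 * \<rho>)" by simp
      also have "\<dots> \<le> C * (g0 \<gamma> * (\<delta>0 s + \<rho>))"
        using C0(1) g0(2)[rule_format, of \<gamma>] \<rho>0 \<delta>0(2)[rule_format, of s] M(1)
        by (intro mult_mono) (auto simp: C_def intro!: mult_nonneg_nonneg)
      finally show ?thesis .
    qed
    also have "\<dots> \<le> C * (g0 \<gamma> * (\<delta> s + \<delta> \<rho>))"
      using \<delta>0(2)[rule_format, of \<rho>] g0' M(1) by (intro mult_left_mono) (auto simp: \<delta>_def C_def s_def)
    also have "\<dots> = g \<gamma> * (\<delta> s + \<delta> \<rho>)" by (simp add: g_def)
    finally show ?thesis by (simp add: h s_def \<rho>_def)
  qed
  show ?thesis
  proof (intro exI[of _ \<delta>] exI[of _ g] conjI \<delta>)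
    show "integrable \<mu> g" using g0(1) by (simp add: g_def)
  qed (use main in blast)
qed

end

theorem proposition4:
  fixes p :: nat and r :: "nat \<Rightarrow> real" and K :: "real set" and \<Theta> :: "(nat \<Rightarrow> real) set"
    and \<pi> :: "(real ^ 'd) set \<Rightarrow> (real ^ 'd) measure measure"
    and \<mu>star :: "(real ^ 'd) measure measure"
    and \<alpha>star :: real and \<theta>star :: "nat \<Rightarrow> real"
  assumes "CARD('d) > 1"
    and "p \<ge> 1" and "r 0 = 0" and "strict_mono_on {0..p} r"
    and "compact K" and "K \<subseteq> {0<..}"
    and "bounded_open_in_Rp p \<Theta>"
    and "\<And>\<Lambda>. \<Lambda> \<in> bounded_borel \<Longrightarrow> poisson_process (density lborel (indicator \<Lambda>)) (\<pi> \<Lambda>)"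
    and "\<alpha>star \<in> K" and "\<theta>star \<in> \<Theta>"
    and "gibbs_measure \<pi> (step_energy p r \<alpha>star \<theta>star) \<mu>star" and "stationary \<mu>star"
  shows
    "(\<comment> \<open>S1\<close>
      \<forall>\<gamma>\<in>(configs :: (real ^ 'd) measure set). \<forall>\<alpha>\<in>K. \<forall>\<theta>\<in>\<Theta>. \<forall>\<theta>'\<in>\<Theta>. \<forall>\<Lambda>\<in>bounded_borel.
        step_energy p r \<alpha> \<theta> \<Lambda> \<gamma> < \<infinity> \<longleftrightarrow> step_energy p r \<alpha> \<theta>' \<Lambda> \<gamma> < \<infinity>)
   \<and> (\<comment> \<open>S2\<close>
      \<forall>\<gamma>\<in>(configs :: (real ^ 'd) measure set). \<forall>\<alpha>\<in>K. \<forall>\<alpha>'\<in>K. \<forall>\<theta>\<in>\<Theta>. \<forall>\<Lambda>\<in>bounded_borel.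
        \<alpha> \<le> \<alpha>' \<longrightarrow> step_energy p r \<alpha> \<theta> \<Lambda> \<gamma> < \<infinity> \<longrightarrow> step_energy p r \<alpha>' \<theta> \<Lambda> \<gamma> < \<infinity>)
   \<and> (\<comment> \<open>S3\<close>
      \<forall>\<alpha>\<in>K. \<alpha> < \<alpha>star \<longrightarrow> (\<exists>R>0. \<forall>\<mu> :: (real ^ 'd) measure measure.
        gibbs_measure \<pi> (step_energy p r \<alpha>star \<theta>star) \<mu> \<and> stationary \<mu> \<longrightarrow>
        measure \<mu> {\<gamma> \<in> space \<mu>. step_energy p r \<alpha> \<theta>star (ball 0 R) \<gamma> = \<infinity>} > 0))
   \<and> (\<comment> \<open>S4\<close>
      \<forall>\<gamma>\<in>(configs :: (real ^ 'd) measure set). \<forall>\<Lambda>\<in>bounded_borel. \<forall>\<theta>\<in>\<Theta>. \<forall>\<alpha>'\<in>K.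
        step_energy p r \<alpha>' \<theta> \<Lambda> \<gamma> < \<infinity> \<longrightarrow>
        (\<exists>\<alpha>. 0 < \<alpha> \<and> \<alpha> < \<alpha>' \<and> step_energy p r \<alpha> \<theta> \<Lambda> \<gamma> < \<infinity>))
   \<and> (\<comment> \<open>H2\<close>
      \<forall>\<alpha>\<in>K. \<forall>\<theta>\<in>\<Theta>. \<forall>(x :: real ^ 'd) y. \<forall>\<gamma>\<in>configs.
        x \<in> removable (step_energy p r \<alpha> \<theta>) (add_point \<gamma> x) \<longrightarrow>
        x + y \<in> removable (step_energy p r \<alpha> \<theta>) (add_point (translate y \<gamma>) (x + y)) \<and>
        local_energy (step_energy p r \<alpha> \<theta>) (x + y) (translate y \<gamma>)
          = local_energy (step_energy p r \<alpha> \<theta>) x \<gamma>)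
   \<and> (\<comment> \<open>H3\<close>
      \<exists>C\<ge>0. \<forall>\<alpha>\<in>K. \<forall>\<theta>\<in>\<Theta>. \<forall>\<gamma>\<in>finite_energy_configs (step_energy p r \<alpha> \<theta>).
        \<forall>x :: real ^ 'd. x \<notin> points \<gamma> \<longrightarrow>
          x \<in> removable (step_energy p r \<alpha> \<theta>) (add_point \<gamma> x) \<and>
          local_energy (step_energy p r \<alpha> \<theta>) x \<gamma> \<ge> ereal (- C))
   \<and> (\<comment> \<open>H4\<close>
      \<forall>\<theta>\<in>\<Theta>. L1_ereal \<mu>star (\<lambda>\<gamma>.
        local_energy (step_energy p r \<alpha>star \<theta>) 0 \<gamma> *
        ereal (boltzmann (local_energy (step_energy p r \<alpha>star \<theta>star) 0 \<gamma>))))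
   \<and> (\<comment> \<open>H5\<close>
      \<forall>\<theta>\<in>\<Theta> - {\<theta>star}.
        measure \<mu>star {\<gamma> \<in> space \<mu>star.
          local_energy (step_energy p r \<alpha>star \<theta>star) 0 \<gamma> \<noteq>
          local_energy (step_energy p r \<alpha>star \<theta>) 0 \<gamma>} > 0)
   \<and> (\<comment> \<open>H6'\<close>
      \<exists>(\<delta> :: real \<Rightarrow> real) g. (\<delta> \<longlongrightarrow> 0) (nhds 0) \<and> integrable \<mu>star g \<and>
        (AE \<gamma> in \<mu>star. \<gamma> \<in> finite_energy_configs (step_energy p r \<alpha>star \<theta>star) \<longrightarrow>
          (\<forall>\<alpha>\<in>K. \<alpha> \<le> \<alpha>star \<longrightarrow> (\<forall>\<theta>\<in>\<Theta>. \<forall>\<theta>'\<in>\<Theta>.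
            0 \<in> removable (step_energy p r \<alpha> \<theta>) (add_point \<gamma> 0) \<and>
            local_energy (step_energy p r \<alpha> \<theta>) 0 \<gamma> < \<infinity> \<longrightarrow>
            \<bar>local_energy (step_energy p r \<alpha> \<theta>) 0 \<gamma> - local_energy (step_energy p r \<alpha>star \<theta>') 0 \<gamma>\<bar>
              \<le> ereal (g \<gamma> * (\<delta> \<bar>\<alpha> - \<alpha>star\<bar> + \<delta> (norm_on p (\<lambda>i. \<theta> i - \<theta>' i))))))))"
proof -
  interpret hard_sphere_model p r K \<Theta>
    using assms(3-7) by unfold_locales
  have model: "hard_sphere_gibbs p r K \<Theta> \<pi> \<alpha>star \<theta>star \<mu>"
    if "gibbs_measure \<pi> (step_energy p r \<alpha>star \<theta>star) \<mu>" for \<mu>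
    using assms(8-10) that by unfold_locales
  interpret hard_sphere_gibbs p r K \<Theta> \<pi> \<alpha>star \<theta>star \<mu>star
    by (rule model[OF assms(11)])
  obtain \<delta> :: "real \<Rightarrow> real" and g where \<delta>: "(\<delta> \<longlongrightarrow> 0) (nhds 0)" "integrable \<mu>star g" and
    h: "\<forall>\<gamma>\<in>finite_energy_configs (step_energy p r \<alpha>star \<theta>star).
          \<forall>\<alpha>\<in>K. \<alpha> \<le> \<alpha>star \<longrightarrow> (\<forall>\<theta>\<in>\<Theta>. \<forall>\<theta>'\<in>\<Theta>.
            0 \<in> removable (step_energy p r \<alpha> \<theta>) (add_point \<gamma> 0) \<and>
            local_energy (step_energy p r \<alpha> \<theta>) 0 \<gamma> < \<infinity> \<longrightarrow>
            \<bar>local_energy (step_energy p r \<alpha> \<theta>) 0 \<gamma> - local_energy (step_energy p r \<alpha>star \<theta>') 0 \<gamma>\<bar>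
              \<le> ereal (g \<gamma> * (\<delta> \<bar>\<alpha> - \<alpha>star\<bar> + \<delta> (norm_on p (\<lambda>i. \<theta> i - \<theta>' i)))))"
    using local_energy_continuity by (elim exE conjE)
  show ?thesis
  proof (intro conjI)
    show "\<forall>\<gamma>\<in>(configs :: (real ^ 'd) measure set). \<forall>\<alpha>\<in>K. \<forall>\<theta>\<in>\<Theta>. \<forall>\<theta>'\<in>\<Theta>. \<forall>\<Lambda>\<in>bounded_borel.
        step_energy p r \<alpha> \<theta> \<Lambda> \<gamma> < \<infinity> \<longleftrightarrow> step_energy p r \<alpha> \<theta>' \<Lambda> \<gamma> < \<infinity>"
      by (intro ballI energy_finite_indep_\<theta>)
    show "\<forall>\<gamma>\<in>(configs :: (real ^ 'd) measure set). \<forall>\<alpha>\<in>K. \<forall>\<alpha>'\<in>K. \<forall>\<theta>\<in>\<Theta>. \<forall>\<Lambda>\<in>bounded_borel.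
        \<alpha> \<le> \<alpha>' \<longrightarrow> step_energy p r \<alpha> \<theta> \<Lambda> \<gamma> < \<infinity> \<longrightarrow> step_energy p r \<alpha>' \<theta> \<Lambda> \<gamma> < \<infinity>"
      using energy_finite_mono by blast
    show "\<forall>\<alpha>\<in>K. \<alpha> < \<alpha>star \<longrightarrow> (\<exists>R>0. \<forall>\<mu> :: (real ^ 'd) measure measure.
        gibbs_measure \<pi> (step_energy p r \<alpha>star \<theta>star) \<mu> \<and> stationary \<mu> \<longrightarrow>
        measure \<mu> {\<gamma> \<in> space \<mu>. step_energy p r \<alpha> \<theta>star (ball 0 R) \<gamma> = \<infinity>} > 0)"
    proof (intro ballI impI)
      fix \<alpha> assume \<alpha>: "\<alpha> \<in> K" "\<alpha> < \<alpha>star"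
      show "\<exists>R>0. \<forall>\<mu> :: (real ^ 'd) measure measure.
          gibbs_measure \<pi> (step_energy p r \<alpha>star \<theta>star) \<mu> \<and> stationary \<mu> \<longrightarrow>
          measure \<mu> {\<gamma> \<in> space \<mu>. step_energy p r \<alpha> \<theta>star (ball 0 R) \<gamma> = \<infinity>} > 0"
        using hard_sphere_gibbs.energy_infinite_pos[OF model \<alpha>] K_pos[OF \<alpha>(1)]
        by (intro exI[of _ "3/\<alpha>"]) auto
    qed
    show "\<forall>\<gamma>\<in>(configs :: (real ^ 'd) measure set). \<forall>\<Lambda>\<in>bounded_borel. \<forall>\<theta>\<in>\<Theta>. \<forall>\<alpha>'\<in>K.
        step_energy p r \<alpha>' \<theta> \<Lambda> \<gamma> < \<infinity> \<longrightarrow>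
        (\<exists>\<alpha>. 0 < \<alpha> \<and> \<alpha> < \<alpha>' \<and> step_energy p r \<alpha> \<theta> \<Lambda> \<gamma> < \<infinity>)"
      by (intro ballI impI energy_finite_open)
    show "\<forall>\<alpha>\<in>K. \<forall>\<theta>\<in>\<Theta>. \<forall>(x :: real ^ 'd) y. \<forall>\<gamma>\<in>configs.
        x \<in> removable (step_energy p r \<alpha> \<theta>) (add_point \<gamma> x) \<longrightarrow>
        x + y \<in> removable (step_energy p r \<alpha> \<theta>) (add_point (translate y \<gamma>) (x + y)) \<and>
        local_energy (step_energy p r \<alpha> \<theta>) (x + y) (translate y \<gamma>)
          = local_energy (step_energy p r \<alpha> \<theta>) x \<gamma>"
      by (intro ballI allI impI conjI local_energy_translate)
    show "\<exists>C\<ge>0. \<forall>\<alpha>\<in>K. \<forall>\<theta>\<in>\<Theta>. \<forall>\<gamma>\<in>finite_energy_configs (step_energy p r \<alpha> \<theta>).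
        \<forall>x :: real ^ 'd. x \<notin> points \<gamma> \<longrightarrow>
          x \<in> removable (step_energy p r \<alpha> \<theta>) (add_point \<gamma> x) \<and>
          local_energy (step_energy p r \<alpha> \<theta>) x \<gamma> \<ge> ereal (- C)"
      by (rule local_energy_ge)
    show "\<forall>\<theta>\<in>\<Theta>. L1_ereal \<mu>star (\<lambda>\<gamma>.
        local_energy (step_energy p r \<alpha>star \<theta>) 0 \<gamma> *
        ereal (boltzmann (local_energy (step_energy p r \<alpha>star \<theta>star) 0 \<gamma>)))"
      by (intro ballI L1_local_energy_boltzmann)
    show "\<forall>\<theta>\<in>\<Theta> - {\<theta>star}. measure \<mu>star {\<gamma> \<in> space \<mu>star.
        local_energy (step_energy p r \<alpha>star \<theta>star) 0 \<gamma> \<noteq> local_energy (step_energy p r \<alpha>star \<theta>) 0 \<gamma>} > 0"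
      using local_energies_differ_pos by simp
  \<comment> \<open>The estimate holds for every \<gamma> of finite energy, hence almost
    surely.\<close>
  qed (intro exI[of _ \<delta>] exI[of _ g] conjI \<delta> AE_I2 impI bspec[OF h])
qed

end
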